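(* Let $N=2^{J-1}$ with $J\ge 2$, and let $\mathbf{x}\in\mathbb{R}^N$ have a one-block support of length $m<N$. Set $\mathbf{y}=(\mathbf{x}^T,(\mathbf{J}_N\mathbf{x})^T)^T\in\mathbb{R}^{2N}$ and assume that $\mathbf{y}$ satisfies the non-cancellation condition: for every $k\in\{0,\dots,2N-1\}$ with $y_k\neq 0$, $$y^{(j)}_{k\bmod 2^j}=\sum_{l=0}^{2^{J-j}-1} y_{(k \bmod 2^j)+2^j l}\neq 0\qquad\text{for all } j\in\{0,\dots,J\}.$$ Further, assume that there is no a priori knowledge of the support length $m$ of $\mathbf{x}$. Then the algorithm "Sparse Fast DCT for Vectors with One-block Support" (the specific procedure given in the context, which computes $\mathbf{x}$ from its discrete cosine transform of type II $\mathbf{x}^{\widehat{\mathrm{II}}}=\mathbf{C}_N^{\mathrm{II}}\mathbf{x}$) has a runtime of $\mathcal{O}\left(m\log m\log\frac{2N}{m}\right)$ and uses $\mathcal{O}\left(m\log\frac{2N}{m}\right)$ samples of $\mathbf{x}^{\widehat{\mathrm{II}}}$.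
   Context: Basic notation. For indices $a,b\in\{0,\dots,n-1\}$ of a vector of length $n$, $I_{a,b}=\{a,(a+1)\bmod n,\dots,b\}$ is a periodic interval. A vector $\mathbf{x}\in\mathbb{R}^N$ has a one-block support of length $m$ if $x_k=0$ for all $k\notin I_{\mu,\nu}$ for some $\mu\in\{0,\dots,N-1\}$, $\nu=(\mu+m-1)\bmod N$, with $m$ the (uniquely determined) smallest such length; zeros inside the interval are allowed. $\mathbf{J}_n=(\delta_{k,n-1-l})_{k,l=0}^{n-1}$ is the counter identity, $\omega_n=e^{-2\pi i/n}$, $\mathbf{F}_n=(\omega_n^{kl})_{k,l=0}^{n-1}$, $\widehat{\mathbf{y}}=\mathbf{F}_{2N}\mathbf{y}$, and IFFT denotes a fast algorithm applying $\mathbf{F}_n^{-1}$ in $\mathcal{O}(n\log n)$ operations. The cosine matrix of type II is $$\mathbf{C}_N^{\mathrm{II}}=\sqrt{\tfrac{2}{N}}\left(\epsilon_N(k)\cos\left(\tfrac{k(2l+1)\pi}{2N}\right)\right)_{k,l=0}^{N-1},$$ where $\epsilon_N(k)=\frac1{\sqrt2}$ if $k\equiv0\bmod N$ and $\epsilon_N(k)=1$ otherwise. For $j\in\{0,\dots,J\}$ the periodization $\mathbf{y}^{(j)}\in\mathbb{R}^{2^j}$ of $\mathbf{y}$ has entries $y^{(j)}_k=\sum_{l=0}^{2^{J-j}-1}y_{k+2^jl}$; thus $\mathbf{y}^{(J)}=\mathbf{y}$. Write $\mathbf{y}^{(j+1)}_{(0)},\mathbf{y}^{(j+1)}_{(1)}\in\mathbb{R}^{2^j}$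 for the first and second half of $\mathbf{y}^{(j+1)}$. The sparse fast DCT algorithm. Input: access to the entries of $\mathbf{x}^{\widehat{\mathrm{II}}}$, and a noise threshold $\varepsilon>0$ such that $|y^{(j)}_{k\bmod 2^j}|>\varepsilon$ for all $j$ whenever $y_k\ne0$. Step 1: whenever a sample $\widehat{y}_k$ is needed in Step 2, compute it as $$\widehat{y}_k=\begin{cases}\frac{\sqrt{2N}}{\epsilon_N(k)}\,\omega_{4N}^{-k}\,x^{\widehat{\mathrm{II}}}_k,&k\in\{0,\dots,N-1\},\\ 0,&k=N,\\ -\frac{\sqrt{2N}}{\epsilon_N(2N-k)}\,\omega_{4N}^{-k}\,x^{\widehat{\mathrm{II}}}_{2N-k},&k\in\{N+1,\dots,2N-1\}.\end{cases}$$ Step 2: compute $\mathbf{y}$ from $\widehat{\mathbf{y}}$ by the sparse FFT below. Step 3: output $\mathbf{x}=(y_k)_{k=0}^{N-1}$. The sparse FFT for vectors with reflected block support (used in Step 2). (If a lower bound $2^{b-1}\le m$ were known, it would start from $\mathbf{y}^{(b)}$, computed by an IFFT of length $2^b$; without such knowledge $b=0$.) It keeps a description of the support of $\mathbf{y}^{(j)}$: either one block $I_{\mu^{(j)},2^j-1-\mu^{(j)}}$ of length $m^{(j)}$, centered around the middle (indices $2^{j-1}-1$, $2^{j-1}$) or around the boundary (indices $2^j-1$, $0$) of the vector, or two separated blocks of length $n^{(j)}$, which are reflections of each other, the first one starting at $\mu^{(j)}$. Start: $\mathbf{y}^{(0)}=\widehat{y}_0$, with one block, $\mu^{(0)}=0$,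 $m^{(0)}=1$. For $j=0,\dots,J-1$ compute $\mathbf{y}^{(j+1)}$ and then detect its support. In the following, "thresholded" means that entries of absolute value at most $\varepsilon$ are set to $0$. (a) One block, $m^{(j)}>2^{j-1}$: $\mathbf{a}=\mathrm{diag}(\omega_{2^{j+1}}^{-l})_{l=0}^{2^j-1}\,\mathrm{IFFT}\big[(\widehat{y}_{2^{J-j-1}(2k+1)})_{k=0}^{2^j-1}\big]$; $\mathbf{y}^{(j+1)}_{(0)}$ is the thresholded vector $\frac12\mathrm{Re}(\mathbf{y}^{(j)}+\mathbf{a})$, and $\mathbf{y}^{(j+1)}_{(1)}=\mathbf{J}_{2^j}\mathbf{y}^{(j+1)}_{(0)}$. (b) One block, $m^{(j)}\le 2^{j-1}$: let $L=\lceil\log_2 m^{(j)}\rceil$, $\mathbf{z}=(y^{(j)}_{(\mu^{(j)}+r)\bmod 2^j})_{r=0}^{2^L-1}$, $\mathbf{v}=(\widehat{y}_{2^{J-L}p+2^{J-j-1}})_{p=0}^{2^L-1}$, and $$\mathbf{a}=\mathrm{diag}\big(\omega_{2^{j+1}}^{-((\mu^{(j)}+r)\bmod 2^j)}\big)_{r=0}^{2^L-1}\,\mathrm{IFFT}\big[\mathrm{diag}(\omega_{2^L}^{-p\mu^{(j)}})_{p=0}^{2^L-1}\mathbf{v}\big].$$ Let $\mathbf{w}$ be the thresholded vector $\frac12\mathrm{Re}(\mathbf{z}+\mathbf{a})$. For $k\in\{0,\dots,2^L-1\}$ the entry of $\mathbf{y}^{(j+1)}_{(0)}$ with index $(\mu^{(j)}+k)\bmod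 2^j$ and the entry of $\mathbf{y}^{(j+1)}_{(1)}$ with index $2^j-1-((\mu^{(j)}+k)\bmod 2^j)$ are set to $w_k$; all other entries are $0$. (c) Two blocks: find a nonzero $\widehat{y}_{2^{J-j-1}(2k_0+1)}$ by taking $k_0$ to maximize $|\widehat{y}_{2^{J-j-1}(2k+1)}|$ over $k\in\{0,\dots,2n^{(j)}-1\}$. Compute $$u=\sum_{l=\mu^{(j)}}^{\mu^{(j)}+n^{(j)}-1}\omega_{2^{j+1}}^{(2k_0+1)l}y^{(j)}_l+\sum_{l=2^{j+1}-n^{(j)}-\mu^{(j)}}^{2^{j+1}-1-\mu^{(j)}}\omega_{2^{j+1}}^{(2k_0+1)l}y^{(j)}_{l-2^j}.$$ Put $\lambda=\mu^{(j)}$ if $|u-\widehat{y}_{2^{J-j-1}(2k_0+1)}|<|u+\widehat{y}_{2^{J-j-1}(2k_0+1)}|$ and $\lambda=2^j+\mu^{(j)}$ otherwise. Set $y^{(j+1)}_k=y^{(j)}_{k\bmod 2^j}$ for $k\in\{\lambda,\dots,\lambda+n^{(j)}-1\}\cup\{2^{j+1}-n^{(j)}-\lambda,\dots,2^{j+1}-1-\lambda\}$ and $y^{(j+1)}_k=0$ otherwise. Support detection for $\mathbf{y}^{(j+1)}$ (an index $k$ is significant if $|y^{(j+1)}_k|>\varepsilon$). (A1) $\mathbf{y}^{(j)}$ has one block with $m^{(j)}<2^j$ centered around the middle: $\mathbf{y}^{(j+1)}$ has two blocks; with $t_1$ and $t_K$ the smallest and largest significant index in $\{\mu^{(j)},\dots,2^j-1-\mu^{(j)}\}$,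 set $\mu^{(j+1)}=t_1$, $n^{(j+1)}=t_K-t_1+1$. (A2) $m^{(j)}=2^j$, $j<J-1$: $\mathbf{y}^{(j+1)}$ has one block. Let $t_1<\dots<t_{2K}$ be the significant indices of $\mathbf{y}^{(j+1)}$, with $t_K\le 2^j-1<t_{K+1}$, and put $d_0=t_{K+1}-t_K$, $d_1=(t_1-t_{2K})\bmod 2^{j+1}$. If $d_0=d_1$, or if the shorter of the lengths $t_{2K}-t_1+1$ and $2^{j+1}-t_{K+1}+t_K+1$ exceeds $2^j$, set $\mu^{(j+1)}=0$, $m^{(j+1)}=2^{j+1}$. Otherwise set $\mu^{(j+1)}=t_1$, $m^{(j+1)}=t_{2K}-t_1+1$ if $d_0<d_1$, and $\mu^{(j+1)}=t_{K+1}$, $m^{(j+1)}=2^{j+1}-t_{K+1}+t_K+1$ if $d_0>d_1$. (A3) $\mathbf{y}^{(j)}$ has one block with $m^{(j)}<2^j$ centered around the boundary, $j<J-1$: $\mathbf{y}^{(j+1)}$ has one block with $m^{(j+1)}=m^{(j)}$, and $\mu^{(j+1)}$ is that one of $\mu^{(j)}$, $2^j+\mu^{(j)}$ for which the sum of $|y^{(j+1)}_k|$ over the periodic interval of length $m^{(j)}$ starting there is larger. (B) $\mathbf{y}^{(j)}$ has two blocks: so does $\mathbf{y}^{(j+1)}$, with $n^{(j+1)}=n^{(j)}$ and $\mu^{(j+1)}=\mu^{(j)}$ if $\lambda=\mu^{(j)}$, $\mu^{(j+1)}=2^j-n^{(j)}-\mu^{(j)}$ otherwise. For $j=J-1$ in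 the situations of (A2) and (A3), the support of $\mathbf{y}$ is read off from the significant entries among those just computed; this does not affect the resulting vector $\mathbf{y}=\mathbf{y}^{(J)}$. Runtime means the number of arithmetical operations; samples are the entries of $\mathbf{x}^{\widehat{\mathrm{II}}}$ that are used. *)

theory Defs
  imports
    Complex_Main
    "HOL-Library.Monad_Syntax"
    "Jordan_Normal_Form.Matrix"
begin

section \<open>Vectors, transforms and supports\<close>

definition periodic_interval :: "nat \<Rightarrow> nat \<Rightarrow> nat \<Rightarrow> nat set" where
  "periodic_interval n a b = {(a + r) mod n | r. r \<le> (b + n - a) mod n}"

text \<open>Lengths start at 1, so the zero vector has a one-block support of length 1.\<close>

definition one_block_support :: "nat \<Rightarrow> real vec \<Rightarrow> nat \<Rightarrow> bool" where
  "one_block_support N x m \<longleftrightarrow>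
     m = (LEAST l. 1 \<le> l \<and> (\<exists>\<mu><N. \<forall>k<N.
            k \<notin> periodic_interval N \<mu> ((\<mu> + l - 1) mod N) \<longrightarrow> x $ k = 0))"

definition counter_identity :: "nat \<Rightarrow> real mat" where
  "counter_identity n = mat n n (\<lambda>(k, l). if k = n - 1 - l then 1 else 0)"

definition omega :: "nat \<Rightarrow> complex" where
  "omega n = exp (- 2 * of_real pi * \<i> / of_nat n)"

definition fourier_mat :: "nat \<Rightarrow> complex mat" where
  "fourier_mat n = mat n n (\<lambda>(k, l). omega n ^ (k * l))"

definition eps :: "nat \<Rightarrow> nat \<Rightarrow> real" where
  "eps N k = (if k mod N = 0 then 1 / sqrt 2 else 1)"

definition cosine_mat_II :: "nat \<Rightarrow> real mat" where
  "cosine_mat_II N = mat N N (\<lambda>(k, l).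
     sqrt (2 / real N) * (eps N k * cos (real k * (2 * real l + 1) * pi / (2 * real N))))"

definition periodization :: "nat \<Rightarrow> nat \<Rightarrow> real vec \<Rightarrow> real vec" where
  "periodization J j y = vec (2 ^ j) (\<lambda>k. \<Sum>l<2 ^ (J - j). y $ (k + 2 ^ j * l))"

definition non_cancellation :: "nat \<Rightarrow> real vec \<Rightarrow> bool" where
  "non_cancellation J y \<longleftrightarrow>
     (\<forall>k<2 ^ J. y $ k \<noteq> 0 \<longrightarrow> (\<forall>j\<le>J. periodization J j y $ (k mod 2 ^ j) \<noteq> 0))"

definition admissible_threshold :: "nat \<Rightarrow> real vec \<Rightarrow> real \<Rightarrow> bool" where
  "admissible_threshold J y \<epsilon> \<longleftrightarrow> 0 < \<epsilon> \<and>
     (\<forall>k<2 ^ J. y $ k \<noteq> 0 \<longrightarrow> (\<forall>j\<le>J. \<bar>periodization J j y $ (k mod 2 ^ j)\<bar> > \<epsilon>))"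


section \<open>Computations with operation count and sample log\<close>

text \<open>
  A computation carries its result, the number of arithmetical operations spent, and the list of
  the indices at which the input vector has been read. Additions, multiplications, divisions,
  comparisons, square roots, absolute values, real parts and evaluations of (powers of) roots of
  unity, of real or complex numbers, cost one unit each. The integer computations that determine
  the support parameters are charged as well. Address arithmetic for reading or placing vector
  entries, copying, and the case distinctions on the current support description are not counted
  as arithmetical operations.
\<close>

datatype 'a comp = Comp (result: 'a) (ops: nat) (samples: "nat list")

definition ret :: "'a \<Rightarrow> 'a comp" where
  "ret a = Comp a 0 []"

definition bind_comp :: "'a comp \<Rightarrow> ('a \<Rightarrow> 'b comp) \<Rightarrow> 'b comp" where
  "bind_comp c f = (let d = f (result c) in
     Comp (result d) (ops c + ops d) (samples c @ samples d))"

adhoc_overloading Monad_Syntax.bind \<rightleftharpoons> bind_comp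

definition charge :: "nat \<Rightarrow> unit comp" where
  "charge n = Comp () n []"

definition op1 :: "('a \<Rightarrow> 'b) \<Rightarrow> 'a \<Rightarrow> 'b comp" where
  "op1 f a = Comp (f a) 1 []"

definition op2 :: "('a \<Rightarrow> 'b \<Rightarrow> 'c) \<Rightarrow> 'a \<Rightarrow> 'b \<Rightarrow> 'c comp" where
  "op2 f a b = Comp (f a b) 1 []"

definition query :: "real vec \<Rightarrow> nat \<Rightarrow> real comp" where
  "query x k = Comp (x $ k) 0 [k]"

primrec mapM :: "('a \<Rightarrow> 'b comp) \<Rightarrow> 'a list \<Rightarrow> 'b list comp" where
  "mapM f [] = ret []"
| "mapM f (x # xs) = do { y \<leftarrow> f x; ys \<leftarrow> mapM f xs; ret (y # ys) }"

primrec filterM :: "('a \<Rightarrow> bool comp) \<Rightarrow> 'a list \<Rightarrow> 'a list comp" where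
  "filterM p [] = ret []"
| "filterM p (x # xs) = do { b \<leftarrow> p x; ys \<leftarrow> filterM p xs; ret (if b then x # ys else ys) }"

primrec foldM :: "('a \<Rightarrow> 'b \<Rightarrow> 'b comp) \<Rightarrow> 'a list \<Rightarrow> 'b \<Rightarrow> 'b comp" where
  "foldM f [] s = ret s"
| "foldM f (x # xs) s = do { t \<leftarrow> f x s; foldM f xs t }"

definition vecM :: "nat \<Rightarrow> (nat \<Rightarrow> 'a comp) \<Rightarrow> 'a vec comp" where
  "vecM n f = do { xs \<leftarrow> mapM f [0..<n]; ret (vec_of_list xs) }"

definition sumM :: "'a::comm_monoid_add list \<Rightarrow> 'a comp" where
  "sumM xs = foldM (\<lambda>x s. op2 (+) s x) xs 0"

definition argmaxM :: "real list \<Rightarrow> nat comp" where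
  "argmaxM as = foldM (\<lambda>k b. do { c \<leftarrow> op2 (<) (as ! b) (as ! k); ret (if c then k else b) })
     [1..<length as] 0"

text \<open>
  An IFFT applies the inverse Fourier matrix exactly, in \<open>O(n log n)\<close> operations and without
  access to the input samples. Only lengths that are powers of two are needed. The maximum
  keeps the bound meaningful for \<open>n = 1\<close>, where \<open>n log n = 0\<close>.
\<close>

definition is_IFFT :: "(complex vec \<Rightarrow> complex vec comp) \<Rightarrow> bool" where
  "is_IFFT ifft \<longleftrightarrow> (\<exists>K::real. \<forall>e. \<forall>v \<in> carrier_vec (2 ^ e).
     result (ifft v) \<in> carrier_vec (2 ^ e) \<and>
     fourier_mat (2 ^ e) *\<^sub>v result (ifft v) = v \<and>
     real (ops (ifft v)) \<le> K * (2 ^ e * max 1 (log 2 (2 ^ e))) \<and>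
     samples (ifft v) = [])"


section \<open>The sparse fast DCT\<close>

definition twiddle :: "nat \<Rightarrow> int \<Rightarrow> complex comp" where
  "twiddle n p = op2 (\<lambda>n p. omega n powi p) n p"

text \<open>\<open>scaled N k l s\<close> computes \<open>sqrt (2 N) / eps N l * omega (4 N) powi (- k) * s\<close>.\<close>

definition scaled :: "nat \<Rightarrow> nat \<Rightarrow> nat \<Rightarrow> real \<Rightarrow> complex comp" where
  "scaled N k l s = do {
     n \<leftarrow> op2 (*) 2 (real N);
     r \<leftarrow> op1 sqrt n;
     e \<leftarrow> op2 eps N l;
     q \<leftarrow> op2 (/) r e;
     t \<leftarrow> twiddle (4 * N) (- int k);
     a \<leftarrow> op2 (*) (of_real q) t;
     op2 (*) a (of_real s) }"

definition yhat :: "nat \<Rightarrow> real vec \<Rightarrow> nat \<Rightarrow> complex comp" where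
  "yhat N xhat k =
    (if k < N then do { s \<leftarrow> query xhat k; scaled N k k s }
     else if k = N then ret 0
     else do { s \<leftarrow> query xhat (2 * N - k); a \<leftarrow> scaled N k (2 * N - k) s; op1 uminus a })"

text \<open>One entry of the thresholded vector \<open>1/2 Re (z + a)\<close>.\<close>

definition half_entry :: "real \<Rightarrow> real \<Rightarrow> complex \<Rightarrow> real comp" where
  "half_entry \<epsilon> z a = do {
     s \<leftarrow> op2 (+) (of_real z) a;
     r \<leftarrow> op1 Re s;
     h \<leftarrow> op2 (*) (1 / 2) r;
     b \<leftarrow> op1 abs h;
     c \<leftarrow> op2 (\<le>) b \<epsilon>;
     ret (if c then 0 else h) }"

text \<open>
  \<open>One_Block \<mu> m\<close> is the periodic interval of length \<open>m\<close> starting at \<open>\<mu>\<close>; \<open>Two_Blocks \<mu> n\<close> are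
  the interval of length \<open>n\<close> starting at \<open>\<mu>\<close> and its reflection. \<open>Index_List\<close> records the support
  explicitly. It is used for the last level, and, with the empty list, whenever the
  detection finds no significant index at all, so that the smallest significant index does not
  exist: the vector is then zero and stays zero.
\<close>

datatype supp = One_Block nat nat | Two_Blocks nat nat | Index_List "nat list"

definition window_length :: "nat \<Rightarrow> nat" where
  "window_length m = nat \<lceil>log 2 (real m)\<rceil>"

definition step_full ::
    "(complex vec \<Rightarrow> complex vec comp) \<Rightarrow> real \<Rightarrow> nat \<Rightarrow> real vec \<Rightarrow> nat \<Rightarrow> real vec \<Rightarrow> real vec comp" where
  "step_full ifft \<epsilon> J xhat j y = do {
     v \<leftarrow> vecM (2 ^ j) (\<lambda>k. yhat (2 ^ (J - 1)) xhat (2 ^ (J - j - 1) * (2 * k + 1)));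
     b \<leftarrow> ifft v;
     w \<leftarrow> vecM (2 ^ j) (\<lambda>l. do {
       t \<leftarrow> twiddle (2 ^ (j + 1)) (- int l);
       a \<leftarrow> op2 (*) t (b $ l);
       half_entry \<epsilon> (y $ l) a });
     ret (w @\<^sub>v (counter_identity (2 ^ j) *\<^sub>v w)) }"

definition step_window ::
    "(complex vec \<Rightarrow> complex vec comp) \<Rightarrow> real \<Rightarrow> nat \<Rightarrow> real vec \<Rightarrow> nat \<Rightarrow> nat \<Rightarrow> nat \<Rightarrow> real vec \<Rightarrow>
     real vec comp" where
  "step_window ifft \<epsilon> J xhat j \<mu> m y = do {
     L \<leftarrow> op1 window_length m;
     v \<leftarrow> vecM (2 ^ L) (\<lambda>p. do {
       s \<leftarrow> yhat (2 ^ (J - 1)) xhat (2 ^ (J - L) * p + 2 ^ (J - j - 1));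
       t \<leftarrow> twiddle (2 ^ L) (- int (p * \<mu>));
       op2 (*) t s });
     b \<leftarrow> ifft v;
     w \<leftarrow> vecM (2 ^ L) (\<lambda>r. do {
       t \<leftarrow> twiddle (2 ^ (j + 1)) (- int ((\<mu> + r) mod 2 ^ j));
       a \<leftarrow> op2 (*) t (b $ r);
       half_entry \<epsilon> (y $ ((\<mu> + r) mod 2 ^ j)) a });
     ret (vec (2 ^ (j + 1))
       (fold (\<lambda>k f. f((\<mu> + k) mod 2 ^ j := w $ k,
                     2 ^ j + (2 ^ j - 1 - (\<mu> + k) mod 2 ^ j) := w $ k))
         [0..<2 ^ L] (\<lambda>_. 0))) }"

text \<open>
  The Boolean in the result of \<open>step_two\<close> tells whether the first block still starts at \<open>\<mu>\<close>, that
  is, whether it is not shifted by \<open>2 ^ j\<close>. \<close>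

definition step_two ::
    "nat \<Rightarrow> real vec \<Rightarrow> nat \<Rightarrow> nat \<Rightarrow> nat \<Rightarrow> real vec \<Rightarrow> (real vec \<times> bool) comp" where
  "step_two J xhat j \<mu> n y = do {
     s \<leftarrow> mapM (\<lambda>k. yhat (2 ^ (J - 1)) xhat (2 ^ (J - j - 1) * (2 * k + 1))) [0..<2 * n];
     as \<leftarrow> mapM (op1 cmod) s;
     k0 \<leftarrow> argmaxM as;
     ts \<leftarrow> mapM (\<lambda>l. do {
         t \<leftarrow> twiddle (2 ^ (j + 1)) (int ((2 * k0 + 1) * l));
         op2 (*) t (of_real (y $ l)) })
       [\<mu>..<\<mu> + n];
     ts' \<leftarrow> mapM (\<lambda>l. do {
         t \<leftarrow> twiddle (2 ^ (j + 1)) (int ((2 * k0 + 1) * l));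
         op2 (*) t (of_real (y $ (l - 2 ^ j))) })
       [2 ^ (j + 1) - n - \<mu>..<2 ^ (j + 1) - \<mu>];
     u \<leftarrow> sumM (ts @ ts');
     d \<leftarrow> op2 (-) u (s ! k0);
     d' \<leftarrow> op1 cmod d;
     e \<leftarrow> op2 (+) u (s ! k0);
     e' \<leftarrow> op1 cmod e;
     c \<leftarrow> op2 (<) d' e';
     start \<leftarrow> (if c then ret \<mu> else op2 (+) (2 ^ j) \<mu>);
     ret (vec (2 ^ (j + 1)) (\<lambda>k.
            if k \<in> {start..<start + n} \<union> {2 ^ (j + 1) - n - start..<2 ^ (j + 1) - start}
            then y $ (k mod 2 ^ j) else 0), c) }"

definition significant :: "real \<Rightarrow> real vec \<Rightarrow> nat \<Rightarrow> bool comp" where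
  "significant \<epsilon> y k = do { a \<leftarrow> op1 abs (y $ k); op2 (<) \<epsilon> a }"

definition detect_middle :: "real \<Rightarrow> nat \<Rightarrow> nat \<Rightarrow> real vec \<Rightarrow> supp comp" where
  "detect_middle \<epsilon> j \<mu> y' = do {
     ts \<leftarrow> filterM (significant \<epsilon> y') [\<mu>..<2 ^ j - \<mu>];
     if ts = [] then ret (Index_List [])
     else do {
       charge 2;
       ret (Two_Blocks (hd ts) (last ts - hd ts + 1)) } }"

text \<open>
  The 12 units are the integer operations for \<open>d0\<close> (1), \<open>d1\<close> (2), the two lengths (2 and 3) and
  the four comparisons.
\<close>

definition detect_full :: "real \<Rightarrow> nat \<Rightarrow> real vec \<Rightarrow> supp comp" where
  "detect_full \<epsilon> j y' = do {
     ts \<leftarrow> filterM (significant \<epsilon> y') [0..<2 ^ (j + 1)];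
     if ts = [] then ret (Index_List [])
     else do {
       charge 12;
       let K = length ts div 2;
       let t1 = hd ts;
       let tK = ts ! (K - 1);
       let tK1 = ts ! K;
       let t2K = last ts;
       let d0 = int tK1 - int tK;
       let d1 = (int t1 - int t2K) mod 2 ^ (j + 1);
       let m0 = t2K - t1 + 1;
       let m1 = 2 ^ (j + 1) - tK1 + tK + 1;
       ret (if d0 = d1 \<or> 2 ^ j < min m0 m1 then One_Block 0 (2 ^ (j + 1))
            else if d0 < d1 then One_Block t1 m0
            else One_Block tK1 m1) } }"

text \<open>If both sums agree, which the description leaves open, the block stays at \<open>\<mu>\<close>.\<close>

definition detect_boundary :: "nat \<Rightarrow> nat \<Rightarrow> nat \<Rightarrow> real vec \<Rightarrow> supp comp" where
  "detect_boundary j \<mu> m y' = do {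
     as \<leftarrow> mapM (\<lambda>r. op1 abs (y' $ ((\<mu> + r) mod 2 ^ (j + 1)))) [0..<m];
     s \<leftarrow> sumM as;
     as' \<leftarrow> mapM (\<lambda>r. op1 abs (y' $ ((2 ^ j + \<mu> + r) mod 2 ^ (j + 1)))) [0..<m];
     s' \<leftarrow> sumM as';
     c \<leftarrow> op2 (<) s s';
     \<mu>' \<leftarrow> (if c then op2 (+) (2 ^ j) \<mu> else ret \<mu>);
     ret (One_Block \<mu>' m) }"

text \<open>The indices of the entries that the step from level \<open>j\<close> to \<open>j + 1\<close> has just computed.\<close>

definition computed :: "nat \<Rightarrow> nat \<Rightarrow> nat \<Rightarrow> nat list" where
  "computed j \<mu> m =
    (if 2 ^ j < 2 * m then [0..<2 ^ (j + 1)]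
     else map (\<lambda>k. (\<mu> + k) mod 2 ^ j) [0..<2 ^ window_length m] @
          map (\<lambda>k. 2 ^ j + (2 ^ j - 1 - (\<mu> + k) mod 2 ^ j)) [0..<2 ^ window_length m])"

text \<open>
  A block \<open>One_Block \<mu> m\<close> with \<open>m < 2 ^ j\<close> is \<open>periodic_interval (2 ^ j) \<mu> (2 ^ j - 1 - \<mu>)\<close>, hence
  centered around the middle if \<open>\<mu> \<le> 2 ^ j - 1 - \<mu>\<close> and around the boundary otherwise.
\<close>

definition detect_one :: "real \<Rightarrow> nat \<Rightarrow> nat \<Rightarrow> nat \<Rightarrow> nat \<Rightarrow> real vec \<Rightarrow> supp comp" where
  "detect_one \<epsilon> J j \<mu> m y' =
    (if m < 2 ^ j \<and> \<mu> \<le> 2 ^ j - 1 - \<mu> then detect_middle \<epsilon> j \<mu> y'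
     else if j = J - 1 then do {
       ts \<leftarrow> filterM (significant \<epsilon> y') (computed j \<mu> m);
       ret (Index_List ts) }
     else if m = 2 ^ j then detect_full \<epsilon> j y'
     else detect_boundary j \<mu> m y')"

fun level ::
    "(complex vec \<Rightarrow> complex vec comp) \<Rightarrow> real \<Rightarrow> nat \<Rightarrow> real vec \<Rightarrow> nat \<Rightarrow> real vec \<times> supp \<Rightarrow>
     (real vec \<times> supp) comp" where
  "level ifft \<epsilon> J xhat j (y, One_Block \<mu> m) = do {
     y' \<leftarrow> (if 2 ^ j < 2 * m then step_full ifft \<epsilon> J xhat j y
            else step_window ifft \<epsilon> J xhat j \<mu> m y);
     S \<leftarrow> detect_one \<epsilon> J j \<mu> m y';
     ret (y', S) }"
| "level ifft \<epsilon> J xhat j (y, Two_Blocks \<mu> n) = do {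
     (y', c) \<leftarrow> step_two J xhat j \<mu> n y;
     \<mu>' \<leftarrow> (if c then ret \<mu> else do { charge 2; ret (2 ^ j - n - \<mu>) });
     ret (y', Two_Blocks \<mu>' n) }"
| "level ifft \<epsilon> J xhat j (y, Index_List _) = ret (0\<^sub>v (2 ^ (j + 1)), Index_List [])"

text \<open>
  No bound on the support length is supplied: the iteration starts from level 0. The real
  part only converts the type, as \<open>yhat\<close> is real at index 0.
\<close>

definition sparse_FFT ::
    "(complex vec \<Rightarrow> complex vec comp) \<Rightarrow> real \<Rightarrow> nat \<Rightarrow> real vec \<Rightarrow> real vec comp" where
  "sparse_FFT ifft \<epsilon> J xhat = do {
     s \<leftarrow> yhat (2 ^ (J - 1)) xhat 0;
     (y, S) \<leftarrow> foldM (level ifft \<epsilon> J xhat) [0..<J] (vec 1 (\<lambda>_. Re s), One_Block 0 1);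
     ret y }"

definition sparse_DCT ::
    "(complex vec \<Rightarrow> complex vec comp) \<Rightarrow> real \<Rightarrow> nat \<Rightarrow> real vec \<Rightarrow> real vec comp" where
  "sparse_DCT ifft \<epsilon> J xhat = do {
     y \<leftarrow> sparse_FFT ifft \<epsilon> J xhat;
     ret (vec (2 ^ (J - 1)) (\<lambda>k. y $ k)) }"

end

theory Submission
  imports Defs
begin

text \<open>
  Every level costs a constant times \<open>s * log s\<close> operations and a constant times \<open>s\<close> samples, where
  \<open>s\<close> is the length of the current support block. The bounds follow once \<open>s\<close> is known to be at most
  \<open>min (2 ^ j) (16 * m)\<close> at level \<open>j\<close>: the levels with \<open>2 ^ j \<le> m\<close> form a geometric sum of order \<open>m\<close>,
  and about \<open>J - log 2 m = log 2 (2 * N / m)\<close> levels of size at most \<open>16 * m\<close> remain.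

  As soon as the block is shorter than the vector, its length can no longer grow: boundary blocks
  keep their length, a middle block splits into two blocks that are not longer, and those keep
  theirs. This holds no matter which entries the algorithm computes. So the size is controlled
  by the moment when the first such block appears, and the whole proof comes down to showing that
  the block stops being full before \<open>2 ^ j\<close> reaches \<open>8 * m\<close>.

  While the block is full, the algorithm computes the periodizations exactly (\<open>result_step_full\<close>):
  the samples are entries of the Fourier transform of the reflected signal (\<open>result_yhat\<close>), the IFFT
  returns the difference of the two halves of the next periodization, and the threshold condition
  makes the thresholding harmless. Hence the detection sees the true support. By symmetry it
  reports a full block only if the support has points on both sides of the midpoint of the
  lower half of the vector (\<open>detect_full_cases\<close>). Folding the indices modulo \<open>2 ^ i\<close> and the
  reflection maps the support to indices less than \<open>m\<close> apart (\<open>support_close\<close>). A cluster that contains the midpoint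
  of the lower half at one level lies at the upper end of the lower half one level before, away
  from the midpoint there, unless the vector is shorter than \<open>8 * m\<close> (\<open>straddles_twice\<close>). So two
  consecutive full blocks force \<open>2 ^ j < 8 * m\<close> at the higher level \<open>j\<close>.
\<close>

section \<open>Resource bounds\<close>

lemma bind_comp_simps [simp]:
  "result (bind_comp c f) = result (f (result c))"
  "ops (bind_comp c f) = ops c + ops (f (result c))"
  "samples (bind_comp c f) = samples c @ samples (f (result c))"
  by (simp_all add: bind_comp_def Let_def)

lemma result_prims [simp]:
  "result (ret a) = a" "result (op1 g a) = g a" "result (op2 h a b) = h a b"
  "result (query x k) = x $ k" "result (charge n) = ()"
  by (simp_all add: ret_def op1_def op2_def query_def charge_def)

text \<open>
  Samples are counted with multiplicity, so that both bounds add up under sequencing; the number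
  of different samples is at most that.
\<close>

definition costs :: "nat \<Rightarrow> nat \<Rightarrow> 'a comp \<Rightarrow> bool" where
  "costs a b c \<longleftrightarrow> ops c \<le> a \<and> length (samples c) \<le> b"

lemma costs_bind:
  "costs a b c \<Longrightarrow> costs a' b' (f (result c)) \<Longrightarrow> costs (a + a') (b + b') (bind_comp c f)"
  by (simp add: costs_def)

lemma costs_mono: "costs a b c \<Longrightarrow> a \<le> a' \<Longrightarrow> b \<le> b' \<Longrightarrow> costs a' b' c"
  by (simp add: costs_def)

lemma costs_prims:
  "costs 0 0 (ret v)" "costs 1 0 (op1 g u)" "costs 1 0 (op2 h v w)" "costs 0 1 (query x k)"
  "costs n 0 (charge n)"
  by (auto simp: costs_def op1_def op2_def query_def charge_def ret_def)

lemma costs_if: "costs a b c \<Longrightarrow> costs a' b' c' \<Longrightarrow> costs (max a a') (max b b') (if P then c else c')"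
  by (auto simp: costs_def)

text \<open>
  Backward chaining with these rules computes the exact cost of straight-line code, which
  \<open>costs_mono\<close> then compares with the claimed bound.
\<close>

lemmas costs_intros = costs_bind costs_prims costs_if

lemma result_mapM [simp]: "result (mapM f xs) = map (\<lambda>x. result (f x)) xs"
  by (induction xs) auto

lemma result_filterM [simp]: "result (filterM p xs) = filter (\<lambda>x. result (p x)) xs"
  by (induction xs) auto

lemma result_vecM [simp]: "result (vecM n f) = vec n (\<lambda>i. result (f i))"
  by (intro eq_vecI) (auto simp: vecM_def vec_of_list_index simp del: vec_of_list_map)

lemma result_vecM_carrier: "result (vecM n f) \<in> carrier_vec n"
  by simp

lemma costs_mapM:
  assumes "\<And>x. costs a b (f x)"
  shows "costs (a * length xs) (b * length xs) (mapM f xs)"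
proof (induction xs)
  case (Cons x xs)
  show ?case
    using assms[of x] Cons by (simp add: costs_def ret_def)
qed (simp add: costs_def ret_def)

lemma costs_filterM:
  assumes "\<And>x. costs a b (p x)"
  shows "costs (a * length xs) (b * length xs) (filterM p xs)"
proof (induction xs)
  case (Cons x xs)
  show ?case
    using assms[of x] Cons by (simp add: costs_def ret_def)
qed (simp add: costs_def ret_def)

lemma costs_foldM:
  assumes "\<And>x s. costs a b (f x s)"
  shows "costs (a * length xs) (b * length xs) (foldM f xs s)"
proof (induction xs arbitrary: s)
  case (Cons x xs)
  show ?case
    using assms[of x s] Cons[of "result (f x s)"] by (simp add: costs_def)
qed (simp add: costs_def ret_def)

lemma costs_vecM:
  assumes "\<And>i. costs a b (f i)"
  shows "costs (a * n) (b * n) (vecM n f)"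
  unfolding vecM_def by (rule costs_mono, (rule costs_intros costs_mapM assms)+) simp_all

lemma costs_sumM: "costs (length xs) 0 (sumM xs)"
  unfolding sumM_def by (rule costs_mono, (rule costs_foldM costs_prims)+) simp_all

lemma costs_argmaxM: "costs (length as) 0 (argmaxM as)"
  unfolding argmaxM_def by (rule costs_mono, (rule costs_foldM costs_intros)+) simp_all

section \<open>Cost of one level\<close>

lemma costs_scaled: "costs 7 0 (scaled N k l s)"
  by (simp add: costs_def scaled_def twiddle_def op1_def op2_def)

lemma costs_yhat: "costs 8 1 (yhat N xhat k)"
  unfolding yhat_def by (rule costs_mono, (rule costs_intros costs_scaled)+) simp_all

lemma costs_half_entry: "costs 5 0 (half_entry \<epsilon> z a)"
  unfolding half_entry_def by (rule costs_mono, (rule costs_intros)+) simp_all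

lemma costs_twiddle: "costs 1 0 (twiddle n p)"
  unfolding twiddle_def by (rule costs_prims)

lemma costs_significant: "costs 2 0 (significant \<epsilon> y k)"
  unfolding significant_def by (rule costs_mono, (rule costs_intros)+) simp_all

text \<open>
  Since \<open>log 2 (2 ^ e) = e\<close>, rounding up the constant moves the IFFT bound to the natural numbers,
  where all other costs live.
\<close>

lemma IFFT_costs:
  assumes "is_IFFT ifft"
  obtains K where "\<And>e v. v \<in> carrier_vec (2 ^ e) \<Longrightarrow> costs (K * (2 ^ e * max 1 e)) 0 (ifft v)"
proof -
  obtain K :: real where K: "\<And>e v. v \<in> carrier_vec (2 ^ e) \<Longrightarrow>
      real (ops (ifft v)) \<le> K * (2 ^ e * max 1 (log 2 (2 ^ e))) \<and> samples (ifft v) = []"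
    using assms unfolding is_IFFT_def by metis
  have "costs (nat \<lceil>K\<rceil> * (2 ^ e * max 1 e)) 0 (ifft v)" if "v \<in> carrier_vec (2 ^ e)" for e v
  proof -
    have "real (ops (ifft v)) \<le> K * (2 ^ e * max 1 (log 2 (2 ^ e)))"
      using K[OF that] by simp
    also have "\<dots> = K * real (2 ^ e * max 1 e)"
      by (simp add: log_nat_power of_nat_max)
    also have "\<dots> \<le> real (nat \<lceil>K\<rceil>) * real (2 ^ e * max 1 e)"
      by (intro mult_right_mono real_nat_ceiling_ge) simp
    finally have "real (ops (ifft v)) \<le> real (nat \<lceil>K\<rceil> * (2 ^ e * max 1 e))"
      by simp
    then show ?thesis
      using K[OF that] by (simp add: costs_def del: of_nat_mult)
  qed
  then show ?thesis
    using that by blast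
qed

lemma costs_step_full:
  assumes ifft: "\<And>e v. v \<in> carrier_vec (2 ^ e) \<Longrightarrow> costs (K * (2 ^ e * max 1 e)) 0 (ifft v)"
  shows "costs (15 * 2 ^ j + K * (2 ^ j * max 1 j)) (2 ^ j) (step_full ifft \<epsilon> J xhat j y)"
  unfolding step_full_def
  by (rule costs_mono,
      (rule costs_intros costs_vecM costs_yhat ifft result_vecM_carrier costs_twiddle costs_half_entry)+)
    simp_all

lemma pow_window_length:
  assumes "1 \<le> p"
  shows "2 ^ window_length p \<le> 2 * p"
proof -
  have "2 ^ window_length p = 2 powr real (window_length p)"
    by (simp add: powr_realpow)
  also have "\<dots> \<le> 2 powr (log 2 (real p) + 1)"
    using assms by (intro powr_mono) (auto simp: window_length_def)
  also have "\<dots> = real (2 * p)"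
    using assms by (simp add: powr_add)
  finally have "real (2 ^ window_length p) \<le> real (2 * p)"
    by simp
  then show ?thesis
    using of_nat_le_iff by blast
qed

lemma costs_step_window:
  fixes p :: nat
  assumes ifft: "\<And>e v. v \<in> carrier_vec (2 ^ e) \<Longrightarrow> costs (K * (2 ^ e * max 1 e)) 0 (ifft v)"
  defines "L \<equiv> window_length p"
  shows "costs (1 + 17 * 2 ^ L + K * (2 ^ L * max 1 L)) (2 ^ L) (step_window ifft \<epsilon> J xhat j \<mu> p y)"
  unfolding step_window_def L_def
  by (rule costs_mono,
      (rule costs_intros costs_vecM costs_yhat ifft result_vecM_carrier costs_twiddle
        costs_half_entry)+)
    simp_all

lemma costs_step_two: "costs (26 * n + 6) (2 * n) (step_two J xhat j \<mu> n y)"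
proof -
  \<comment> \<open>The truncated subtraction can only shorten the reflected block, whatever \<open>\<mu>\<close> is.\<close>
  have second: "length [2 ^ (j + 1) - n - \<mu>..<2 ^ (j + 1) - \<mu>] \<le> n"
    by simp
  show ?thesis
    unfolding step_two_def
    by (rule costs_mono,
        (rule costs_intros costs_mapM costs_yhat costs_argmaxM costs_sumM costs_twiddle)+)
      (use second in simp_all)
qed

lemma costs_detect_middle:
  assumes "2 * \<mu> < 2 ^ j"
  shows "costs (2 * (2 ^ j - 2 * \<mu>) + 2) 0 (detect_middle \<epsilon> j \<mu> y')"
  unfolding detect_middle_def
  by (rule costs_mono, (rule costs_intros costs_filterM costs_significant)+) (use assms in simp_all)

lemma costs_detect_full: "costs (2 * 2 ^ (j + 1) + 12) 0 (detect_full \<epsilon> j y')"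
  unfolding detect_full_def Let_def
  by (rule costs_mono, (rule costs_intros costs_filterM costs_significant)+) simp_all

lemma costs_detect_boundary: "costs (4 * p + 2) 0 (detect_boundary j \<mu> p y')"
  unfolding detect_boundary_def
  by (rule costs_mono, (rule costs_intros costs_mapM costs_sumM)+) simp_all

lemma length_computed:
  assumes "1 \<le> p"
  shows "length (computed j \<mu> p) \<le> 4 * p"
  using pow_window_length[OF assms] by (auto simp: computed_def)

text \<open>
  All work of a level is linear, up to the logarithm in the IFFT, in this number. A recorded index
  list counts as empty because no level after it computes anything.
\<close>

fun supp_size :: "supp \<Rightarrow> nat" where
  "supp_size (One_Block \<mu> p) = p"
| "supp_size (Two_Blocks \<mu> n) = n"
| "supp_size (Index_List ts) = 0"

text \<open>
  A block in the middle is scanned from \<open>\<mu>\<close> to its mirror image rather than over its recorded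
  length, so the bound needs that the block is centered.
\<close>

lemma costs_detect_one:
  assumes "1 \<le> p" "2 * \<mu> < 2 ^ j \<Longrightarrow> p = 2 ^ j \<or> p = 2 ^ j - 2 * \<mu>"
  shows "costs (16 * p) 0 (detect_one \<epsilon> J j \<mu> p y')"
proof (cases "p < 2 ^ j \<and> \<mu> \<le> 2 ^ j - 1 - \<mu>")
  case True
  then have mid: "2 * \<mu> < 2 ^ j"
    by linarith
  show ?thesis
    using True mid assms costs_detect_middle[OF mid, of \<epsilon> y']
    by (auto simp: detect_one_def elim!: costs_mono)
next
  case False
  have read_off: "costs (16 * p) 0 (do {
      ts \<leftarrow> filterM (significant \<epsilon> y') (computed j \<mu> p); ret (Index_List ts) })"
    by (rule costs_mono, (rule costs_intros costs_filterM costs_significant)+)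
      (use length_computed[OF assms(1), of j \<mu>] in simp_all)
  have full: "costs (16 * p) 0 (detect_full \<epsilon> j y')" if "p = 2 ^ j"
    using assms that by (intro costs_mono[OF costs_detect_full]) simp_all
  have boundary: "costs (16 * p) 0 (detect_boundary j \<mu> p y')"
    using assms by (intro costs_mono[OF costs_detect_boundary]) simp_all
  show ?thesis
    using False read_off full boundary by (auto simp: detect_one_def)
qed

section \<open>The Fourier transform of a periodization\<close>

lemma omega_power_cis: "omega n ^ k = cis (- (2 * pi * real k / real n))"
proof -
  have "omega n ^ k = exp (of_nat k * (- 2 * of_real pi * \<i> / of_nat n))"
    unfolding omega_def by (rule exp_of_nat_mult[symmetric])
  also have "of_nat k * (- 2 * of_real pi * \<i> / of_nat n)
      = \<i> * of_real (- (2 * pi * real k / real n))"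
    by simp
  finally show ?thesis
    by (simp add: cis_conv_exp)
qed

lemma omega_nonzero [simp]: "omega n \<noteq> 0"
  by (simp add: omega_def)

lemma omega_power_self [simp]: "0 < n \<Longrightarrow> omega n ^ n = 1"
  by (simp add: omega_power_cis complex_eq_iff)

lemma omega_power_mult: "0 < a \<Longrightarrow> omega (a * n) ^ (a * k) = omega n ^ k"
  by (simp add: omega_power_cis mult.assoc)

lemma omega_power_add_period: "0 < n \<Longrightarrow> omega n ^ (k + n * l) = omega n ^ k"
  by (simp add: power_add power_mult)

text \<open>The powers are the conjugates of the roots of unity in \<open>bij_betw_roots_unity\<close>.\<close>

lemma omega_power_inj:
  assumes "k < n" "l < n" "omega n ^ k = omega n ^ l"
  shows "k = l"
proof -
  have "cis (2 * pi * real k / real n) = cis (2 * pi * real l / real n)"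
    using arg_cong[OF assms(3), of inverse] by (simp add: omega_power_cis)
  moreover have "inj_on (\<lambda>k. cis (2 * pi * real k / real n)) {..<n}"
    using bij_betw_roots_unity[of n] assms by (auto simp: bij_betw_def)
  ultimately show ?thesis
    using assms by (auto dest: inj_onD)
qed

text \<open>A geometric sum over a root of unity other than 1.\<close>

lemma omega_orthogonal:
  assumes "l < n" "i < n"
  shows "(\<Sum>k<n. inverse (omega n ^ (k * i)) * omega n ^ (k * l)) = (if l = i then of_nat n else 0)"
proof -
  define z where "z = inverse (omega n ^ i) * omega n ^ l"
  have zk: "inverse (omega n ^ (k * i)) * omega n ^ (k * l) = z ^ k" for k
    by (simp add: z_def power_mult_distrib power_inverse mult.commute[of k] flip: power_mult)
  show ?thesis
  proof (cases "l = i")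
    case True
    then show ?thesis
      unfolding zk by (simp add: z_def)
  next
    case False
    have "z \<noteq> 1"
    proof
      assume "z = 1"
      then have "omega n ^ l = omega n ^ i"
        by (simp add: z_def field_simps)
      with False show False
        using omega_power_inj assms by blast
    qed
    moreover have "z ^ n = 1"
      using assms
      by (simp add: z_def power_mult_distrib power_inverse power_mult mult.commute[of i] mult.commute[of l]
          power_commuting_commutes power_mult[of _ i n, symmetric] power_mult[of _ l n, symmetric])
    ultimately show ?thesis
      unfolding zk using False by (simp add: geometric_sum)
  qed
qed

lemma fourier_mat_mult_index:
  assumes "b \<in> carrier_vec n" "k < n"
  shows "(fourier_mat n *\<^sub>v b) $ k = (\<Sum>l<n. omega n ^ (k * l) * b $ l)"
  using assms by (auto simp: fourier_mat_def scalar_prod_def lessThan_atLeast0 intro!: sum.cong)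

text \<open>
  An IFFT is only known to be a right inverse of the Fourier matrix; injectivity, from the
  inversion formula, identifies its result with an expected preimage.
\<close>

lemma fourier_mat_inj:
  assumes b: "b \<in> carrier_vec n" and c: "c \<in> carrier_vec n"
    and eq: "fourier_mat n *\<^sub>v b = fourier_mat n *\<^sub>v c"
  shows "b = c"
proof -
  have inversion: "(\<Sum>k<n. inverse (omega n ^ (k * i)) * (fourier_mat n *\<^sub>v d) $ k) = of_nat n * d $ i"
    if d: "d \<in> carrier_vec n" and i: "i < n" for d i
  proof -
    have "(\<Sum>k<n. inverse (omega n ^ (k * i)) * (fourier_mat n *\<^sub>v d) $ k)
        = (\<Sum>k<n. \<Sum>l<n. inverse (omega n ^ (k * i)) * omega n ^ (k * l) * d $ l)"
      by (intro sum.cong refl) (simp add: fourier_mat_mult_index[OF d] sum_distrib_left mult.assoc)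
    also have "\<dots> = (\<Sum>l<n. (\<Sum>k<n. inverse (omega n ^ (k * i)) * omega n ^ (k * l)) * d $ l)"
      by (subst sum.swap) (simp add: sum_distrib_right)
    also have "\<dots> = (\<Sum>l<n. if l = i then of_nat n * d $ l else 0)"
      by (intro sum.cong refl) (simp add: omega_orthogonal i)
    also have "\<dots> = of_nat n * d $ i"
      using i by simp
    finally show ?thesis .
  qed
  show ?thesis
  proof (intro eq_vecI)
    fix i assume "i < dim_vec c"
    then have "i < n"
      using c by simp
    then show "b $ i = c $ i"
      using inversion[OF b, of i] inversion[OF c, of i] eq by simp
  qed (use b c in simp)
qed

definition dft :: "nat \<Rightarrow> real vec \<Rightarrow> nat \<Rightarrow> complex" where
  "dft n y k = (\<Sum>l<n. omega n ^ (k * l) * of_real (y $ l))"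

text \<open>
  Writing \<open>l = a + 2 ^ i * b\<close>, the frequency \<open>2 ^ (J - i) * k\<close> does not see \<open>b\<close>, so the sum over \<open>b\<close>
  acts on the signal alone and periodizes it.
\<close>

lemma dft_periodization:
  assumes "i \<le> J"
  shows "dft (2 ^ J) y (2 ^ (J - i) * k) = dft (2 ^ i) (periodization J i y) k"
proof -
  let ?g = "\<lambda>l. omega (2 ^ J) ^ (2 ^ (J - i) * k * l) * complex_of_real (y $ l)"
  have J: "2 ^ J = (2 ^ (J - i) * 2 ^ i :: nat)"
    using assms by (simp flip: power_add)
  have rot: "omega (2 ^ J) ^ (2 ^ (J - i) * k * (a + 2 ^ i * b)) = omega (2 ^ i) ^ (k * a)" for a b
  proof -
    have "omega (2 ^ J) ^ (2 ^ (J - i) * k * (a + 2 ^ i * b)) = omega (2 ^ i) ^ (k * (a + 2 ^ i * b))"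
      unfolding J mult.assoc by (rule omega_power_mult) simp
    also have "\<dots> = omega (2 ^ i) ^ (k * a + 2 ^ i * (k * b))"
      by (rule arg_cong[of _ _ "power _"]) (simp add: algebra_simps)
    also have "omega (2 ^ i) ^ (k * a + 2 ^ i * (k * b)) = omega (2 ^ i) ^ (k * a)"
      by (rule omega_power_add_period) simp
    finally show ?thesis .
  qed
  have segment: "sum ?g {b * 2 ^ i..<b * 2 ^ i + 2 ^ i} = (\<Sum>a<2 ^ i. ?g (a + 2 ^ i * b))" for b
    by (rule sum.reindex_bij_witness[where i = "\<lambda>a. a + 2 ^ i * b" and j = "\<lambda>l. l - 2 ^ i * b"])
      (auto simp: mult.commute)
  have "dft (2 ^ J) y (2 ^ (J - i) * k) = sum ?g {..<2 ^ (J - i) * 2 ^ i}"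
    by (simp add: dft_def flip: J)
  also have "\<dots> = (\<Sum>b<2 ^ (J - i). sum ?g {b * 2 ^ i..<b * 2 ^ i + 2 ^ i})"
    by (rule sum.nat_group[symmetric])
  also have "\<dots> = (\<Sum>b<2 ^ (J - i). \<Sum>a<2 ^ i. ?g (a + 2 ^ i * b))"
    unfolding segment ..
  also have "\<dots> = (\<Sum>a<2 ^ i. \<Sum>b<2 ^ (J - i). omega (2 ^ i) ^ (k * a) * of_real (y $ (a + 2 ^ i * b)))"
    unfolding rot by (rule sum.swap)
  also have "\<dots> = dft (2 ^ i) (periodization J i y) k"
    by (simp add: dft_def periodization_def sum_distrib_left)
  finally show ?thesis .
qed

lemma sum_lessThan_add: "sum f {..<m + n} = sum f {..<m} + (\<Sum>i<n. f (i + m))"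
  for f :: "nat \<Rightarrow> 'a::comm_monoid_add"
  by (induction n) (simp_all add: ac_simps)

text \<open>
  The odd frequencies see only the difference of the two halves, because a shift by half the
  period changes the sign of the root of unity.
\<close>

lemma dft_odd:
  "dft (2 ^ (j + 1)) y (2 * k + 1)
   = (\<Sum>l<2 ^ j. omega (2 ^ j) ^ (k * l) * (omega (2 ^ (j + 1)) ^ l * of_real (y $ l - y $ (l + 2 ^ j))))"
proof -
  let ?w = "omega (2 ^ (j + 1))"
  let ?g = "\<lambda>l. ?w ^ ((2 * k + 1) * l) * complex_of_real (y $ l)"
  have half: "?w ^ 2 ^ j = - 1"
    by (simp add: omega_power_cis complex_eq_iff)
  have rot: "?w ^ ((2 * k + 1) * l) = omega (2 ^ j) ^ (k * l) * ?w ^ l" for l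
  proof -
    have "?w ^ ((2 * k + 1) * l) = omega (2 * 2 ^ j) ^ (2 * (k * l)) * ?w ^ l"
      by (simp add: algebra_simps power_add)
    then show ?thesis
      by (simp add: omega_power_mult)
  qed
  have shift: "?w ^ ((2 * k + 1) * (l + 2 ^ j)) = - (?w ^ ((2 * k + 1) * l))" for l
  proof -
    have "?w ^ ((2 * k + 1) * (l + 2 ^ j)) = ?w ^ ((2 * k + 1) * l) * (?w ^ 2 ^ j) ^ (2 * k + 1)"
      by (simp add: algebra_simps power_add flip: power_mult)
    then show ?thesis
      unfolding half by simp
  qed
  have "dft (2 ^ (j + 1)) y (2 * k + 1) = sum ?g {..<2 ^ j + 2 ^ j}"
    by (simp add: dft_def mult_2)
  also have "\<dots> = sum ?g {..<2 ^ j} + (\<Sum>l<2 ^ j. ?g (l + 2 ^ j))"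
    by (rule sum_lessThan_add)
  also have "\<dots> = (\<Sum>l<2 ^ j. ?w ^ ((2 * k + 1) * l) * of_real (y $ l - y $ (l + 2 ^ j)))"
    unfolding shift by (simp add: algebra_simps flip: sum.distrib)
  finally show ?thesis
    unfolding rot by (simp add: mult.assoc)
qed

lemma sum_even_odd: "(\<Sum>l<2 * n. f l) = (\<Sum>l<n. f (2 * l) + f (2 * l + 1))"
  for f :: "nat \<Rightarrow> 'a::comm_monoid_add"
  by (induction n) (simp_all add: ac_simps)

text \<open>Even and odd multiples of \<open>2 ^ j\<close> feed the first and the second half.\<close>

lemma periodization_halves:
  assumes "j < J" "k < 2 ^ j"
  shows "periodization J j y $ k
    = periodization J (j + 1) y $ k + periodization J (j + 1) y $ (k + 2 ^ j)"
proof -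
  have "2 ^ (J - j) = (2 * 2 ^ (J - (j + 1)) :: nat)"
    using assms by (simp add: Suc_diff_Suc flip: power_Suc)
  then show ?thesis
    using assms
    by (simp add: periodization_def sum_even_odd sum.distrib algebra_simps del: mult_2)
qed

section \<open>Samples of the transform\<close>

lemma reflected_index:
  assumes "x \<in> carrier_vec N" "y = x @\<^sub>v (counter_identity N *\<^sub>v x)" "l < N"
  shows "y $ l = x $ l" "y $ (2 * N - 1 - l) = x $ l"
proof -
  show "y $ l = x $ l"
    using assms by (simp add: counter_identity_def)
  have ge: "N \<le> 2 * N - 1 - l" and lt: "2 * N - 1 - l - N < N"
    and idx: "N - 1 - l = 2 * N - 1 - l - N"
    using assms(3) by auto
  have "y $ (2 * N - 1 - l) = (counter_identity N *\<^sub>v x) $ (2 * N - 1 - l - N)"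
    using assms ge lt by (simp add: counter_identity_def)
  also have "\<dots> = (\<Sum>i<N. (if N - 1 - l = N - 1 - i then 1 else 0) * x $ i)"
    using assms(1) lt unfolding counter_identity_def
    by (simp add: scalar_prod_def lessThan_atLeast0 flip: idx)
  also have "\<dots> = (\<Sum>i<N. if i = l then x $ i else 0)"
    using assms(3) by (intro sum.cong) auto
  also have "\<dots> = x $ l"
    using assms by simp
  finally show "y $ (2 * N - 1 - l) = x $ l" .
qed

text \<open>
  The entries \<open>l\<close> and \<open>2 * N - 1 - l\<close> agree, and their two roots of unity are conjugate up to the
  common factor \<open>omega (4 * N) powi (- k)\<close>. Each pair thus contributes a cosine.
\<close>

lemma dft_reflected:
  assumes x: "x \<in> carrier_vec N" and y: "y = x @\<^sub>v (counter_identity N *\<^sub>v x)" and N: "0 < N"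
  shows "dft (2 * N) y k = omega (4 * N) powi (- int k) *
    of_real (\<Sum>l<N. 2 * cos (real k * (2 * real l + 1) * pi / (2 * real N)) * x $ l)"
proof -
  let ?w = "omega (2 * N)" and ?g = "\<lambda>l. omega (2 * N) ^ (k * l) * complex_of_real (y $ l)"
  let ?\<theta> = "\<lambda>l. real k * (2 * real l + 1) * pi / (2 * real N)"
  have pair: "?w ^ (k * l) + ?w ^ (k * (2 * N - 1 - l)) = omega (4 * N) powi (- int k) * of_real (2 * cos (?\<theta> l))"
    if l: "l < N" for l
  proof -
    have inv: "omega (4 * N) powi (- int k) = cis (2 * pi * real k / real (4 * N))"
      by (simp add: power_int_minus omega_power_cis)
    have "?w ^ (k * l) = cis (2 * pi * real k / real (4 * N) - ?\<theta> l)"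
      using N unfolding omega_power_cis by (intro arg_cong[of _ _ cis]) (simp add: field_simps)
    moreover have "?w ^ (k * (2 * N - 1 - l)) = cis (2 * pi * real k / real (4 * N) + ?\<theta> l)"
    proof -
      have idx: "k * (2 * N - 1 - l) + k * (l + 1) = 2 * N * k"
        using l unfolding add_mult_distrib2[symmetric] by (simp add: mult.commute)
      have "?w ^ (k * (2 * N - 1 - l)) * ?w ^ (k * (l + 1)) = (?w ^ (2 * N)) ^ k"
        unfolding power_add[symmetric] by (simp only: idx power_mult)
      then have "?w ^ (k * (2 * N - 1 - l)) = inverse (?w ^ (k * (l + 1)))"
        using N by (simp add: field_simps)
      also have "\<dots> = cis (2 * pi * real k / real (4 * N) + ?\<theta> l)"
        using N unfolding omega_power_cis cis_inverse
        by (intro arg_cong[of _ _ cis]) (simp add: field_simps)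
      finally show ?thesis .
    qed
    ultimately show ?thesis
      unfolding inv by (simp add: complex_eq_iff cos_add cos_diff sin_add sin_diff algebra_simps)
  qed
  have "dft (2 * N) y k = sum ?g {..<N + N}"
    by (simp add: dft_def mult_2)
  also have "\<dots> = sum ?g {..<N} + (\<Sum>l<N. ?g (l + N))"
    by (rule sum_lessThan_add)
  also have "(\<Sum>l<N. ?g (l + N)) = (\<Sum>l<N. ?g (N - Suc l + N))"
    by (rule sum.nat_diff_reindex[symmetric])
  also have "\<dots> = (\<Sum>l<N. ?g (2 * N - 1 - l))"
    by (intro sum.cong refl arg_cong[of _ _ ?g]) auto
  also have "sum ?g {..<N} + (\<Sum>l<N. ?g (2 * N - 1 - l))
      = (\<Sum>l<N. (?w ^ (k * l) + ?w ^ (k * (2 * N - 1 - l))) * of_real (x $ l))"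
    using reflected_index[OF x y] by (simp add: sum.distrib distrib_right)
  also have "\<dots> = (\<Sum>l<N. omega (4 * N) powi (- int k) * of_real (2 * cos (?\<theta> l)) * of_real (x $ l))"
    by (intro sum.cong refl arg_cong2[of _ _ _ _ "(*)"] pair) auto
  finally show ?thesis
    by (simp add: sum_distrib_left mult.assoc)
qed

lemma cosine_mat_II_mult_index:
  assumes "x \<in> carrier_vec N" "k < N"
  shows "(cosine_mat_II N *\<^sub>v x) $ k = sqrt (2 / real N) * eps N k *
    (\<Sum>l<N. cos (real k * (2 * real l + 1) * pi / (2 * real N)) * x $ l)"
  using assms
  by (auto simp: cosine_mat_II_def scalar_prod_def lessThan_atLeast0 sum_distrib_left mult.assoc
      intro!: sum.cong)

lemma result_scaled_cosine:
  assumes "x \<in> carrier_vec N" "l < N"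
  shows "result (scaled N k l ((cosine_mat_II N *\<^sub>v x) $ l)) = omega (4 * N) powi (- int k) *
    of_real (\<Sum>i<N. 2 * cos (real l * (2 * real i + 1) * pi / (2 * real N)) * x $ i)"
proof -
  let ?S = "\<Sum>i<N. cos (real l * (2 * real i + 1) * pi / (2 * real N)) * x $ i"
  have N: "0 < N"
    using assms by simp
  have e: "eps N l \<noteq> 0"
    by (simp add: eps_def)
  have "sqrt (2 * real N) * sqrt (2 / real N) = sqrt (2 * real N * (2 / real N))"
    by (rule real_sqrt_mult[symmetric])
  also have "\<dots> = 2"
    using N by simp
  finally have two: "sqrt (2 * real N) * sqrt (2 / real N) = 2" .
  have "sqrt (2 * real N) / eps N l * (sqrt (2 / real N) * eps N l * S)
      = sqrt (2 * real N) * sqrt (2 / real N) * S" for S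
    using e by simp
  then have scale: "complex_of_real (sqrt (2 * real N) / eps N l) * of_real (sqrt (2 / real N) * eps N l * S)
      = of_real (2 * S)" for S
    unfolding two of_real_mult[symmetric] by (rule arg_cong)
  have "result (scaled N k l s) = omega (4 * N) powi (- int k) *
      (of_real (sqrt (2 * real N) / eps N l) * of_real s)" for s
    by (simp add: scaled_def twiddle_def del: of_real_divide)
  moreover have "(\<Sum>i<N. 2 * cos (real l * (2 * real i + 1) * pi / (2 * real N)) * x $ i) = 2 * ?S"
    by (simp only: sum_distrib_left mult.assoc)
  ultimately show ?thesis
    unfolding cosine_mat_II_mult_index[OF assms] by (simp only: scale)
qed

text \<open>
  The formula of \<open>dft_reflected\<close> holds for every frequency. The cosines vanish at \<open>k = N\<close> and are odd
  under \<open>k \<mapsto> 2 * N - k\<close>, which gives the three cases of \<open>yhat\<close>.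
\<close>

lemma result_yhat:
  assumes x: "x \<in> carrier_vec N" and y: "y = x @\<^sub>v (counter_identity N *\<^sub>v x)" and k: "k < 2 * N"
  shows "result (yhat N (cosine_mat_II N *\<^sub>v x) k) = dft (2 * N) y k"
proof -
  have N: "0 < N"
    using k by simp
  consider "k < N" | "k = N" | "N < k"
    by linarith
  then show ?thesis
  proof cases
    case 1
    then show ?thesis
      by (simp add: yhat_def result_scaled_cosine[OF x] dft_reflected[OF x y N])
  next
    case 2
    have "cos (real N * (2 * real l + 1) * pi / (2 * real N)) = 0" for l
    proof -
      have "real N * (2 * real l + 1) * pi / (2 * real N) = real l * pi + pi / 2"
        using N by (simp add: field_simps)
      then show ?thesis
        by (simp add: cos_add)
    qed
    then show ?thesis
      unfolding 2 dft_reflected[OF x y N] by (simp only: mult_zero_right mult_zero_left sum.neutral_const)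
        (simp add: yhat_def)
  next
    case 3
    have "cos (real (2 * N - k) * (2 * real l + 1) * pi / (2 * real N))
        = - cos (real k * (2 * real l + 1) * pi / (2 * real N))" for l
    proof -
      have "real (2 * N - k) * (2 * real l + 1) * pi / (2 * real N)
          = real (2 * l + 1) * pi - real k * (2 * real l + 1) * pi / (2 * real N)"
        using N k by (simp add: of_nat_diff field_simps)
      moreover have "cos (real (2 * l + 1) * pi) = - 1" "sin (real (2 * l + 1) * pi) = 0"
        using cos_npi[of "2 * l + 1"] sin_npi[of "2 * l + 1"] by simp_all
      ultimately show ?thesis
        by (simp add: cos_diff)
    qed
    moreover have "2 * N - k < N"
      using 3 k by simp
    ultimately show ?thesis
      using 3 by (simp add: yhat_def result_scaled_cosine[OF x] dft_reflected[OF x y N] sum_negf)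
  qed
qed

section \<open>Folding indices\<close>

text \<open>
  The index \<open>k\<close> modulo \<open>M\<close>, moved to the lower half of \<open>{0..<M}\<close> by the reflection
  \<open>k \<mapsto> M - 1 - k\<close>. Folding makes one-block supports tractable: it
  ignores both the wrap-around of a periodic interval and the reflection of the signal, and it
  is 1-Lipschitz, so that a block of length \<open>m\<close> folds to indices less than \<open>m\<close> apart.
\<close>

definition fold_index :: "nat \<Rightarrow> nat \<Rightarrow> nat" where
  "fold_index M k = min (k mod M) (M - 1 - k mod M)"

lemma fold_index_Suc:
  assumes "0 < M"
  shows "fold_index M (Suc k) \<le> Suc (fold_index M k)" "fold_index M k \<le> Suc (fold_index M (Suc k))"
  using assms mod_less_divisor[OF assms, of k] by (auto simp: fold_index_def mod_Suc)

lemma fold_index_add: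
  assumes "0 < M"
  shows "fold_index M (k + d) \<le> fold_index M k + d" "fold_index M k \<le> fold_index M (k + d) + d"
proof (induction d)
  case (Suc d)
  case 1
  show ?case
    using Suc fold_index_Suc[OF assms, of "k + d"] by simp
  case 2
  show ?case
    using Suc fold_index_Suc[OF assms, of "k + d"] by simp
qed simp_all

lemma fold_index_close:
  assumes "0 < M" "r < m" "s < m"
  shows "fold_index M (k + r) < fold_index M (k + s) + m"
proof (cases "r \<le> s")
  case True
  then show ?thesis
    using fold_index_add(2)[OF assms(1), of "k + r" "s - r"] assms by simp
next
  case False
  then show ?thesis
    using fold_index_add(1)[OF assms(1), of "k + s" "r - s"] assms by simp
qed

lemma fold_index_mod: "M dvd N \<Longrightarrow> fold_index M (k mod N) = fold_index M k"
  by (simp add: fold_index_def mod_mod_cancel)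

lemma fold_index_reflect:
  assumes "M dvd N" "k < N"
  shows "fold_index M (N - 1 - k) = fold_index M k"
proof -
  obtain c where N: "N = M * c"
    using assms by blast
  have M: "0 < M"
    using assms N by (cases M) auto
  define q where "q = k div M"
  define r where "r = k mod M"
  have k: "k = M * q + r" and r: "r < M"
    using M by (simp_all add: q_def r_def)
  have "q < c"
    using assms N M by (simp add: q_def less_mult_imp_div_less mult.commute)
  then obtain d where c: "c = q + d + 1"
    using less_imp_add_positive[of q c] by (metis Suc_eq_plus1 add_Suc_right gr0_implies_Suc)
  have "N - 1 - k = M - 1 - r + M * d"
    using r by (simp add: N k c algebra_simps)
  then have "(N - 1 - k) mod M = (M - 1 - r) mod M"
    by (simp only: mod_mult_self2)
  then have "(N - 1 - k) mod M = M - 1 - r"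
    using M by simp
  then show ?thesis
    using r by (simp add: fold_index_def min.commute flip: r_def)
qed

lemma fold_index_double:
  assumes "0 < M"
  shows "fold_index M k = min (fold_index (2 * M) k) (M - 1 - fold_index (2 * M) k)"
    and "fold_index (2 * M) k < M"
proof -
  have "k mod M < M" "k mod (2 * M) = k mod M \<or> k mod (2 * M) = k mod M + M"
    using assms mod_double_nat[of k M] by auto
  then show "fold_index M k = min (fold_index (2 * M) k) (M - 1 - fold_index (2 * M) k)"
    "fold_index (2 * M) k < M"
    by (auto simp: fold_index_def)
qed

section \<open>Detection of the support after a full step\<close>

lemma result_significant [simp]: "result (significant \<epsilon> y k) \<longleftrightarrow> \<epsilon> < \<bar>y $ k\<bar>"
  by (simp add: significant_def)

text \<open>
  Turns the upper entries of a symmetric index list into reflections of the ends of its lower half.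
\<close>

lemma filter_symmetric:
  assumes "\<And>k. k < 2 * n \<Longrightarrow> P (2 * n - 1 - k) \<longleftrightarrow> P k"
  shows "filter P [n..<2 * n] = rev (map (\<lambda>k. 2 * n - 1 - k) (filter P [0..<n]))"
proof -
  have "[n..<2 * n] = rev (map (\<lambda>k. 2 * n - 1 - k) [0..<n])"
    by (rule nth_equalityI) (auto simp: rev_nth)
  moreover have "filter (P \<circ> (\<lambda>k. 2 * n - 1 - k)) [0..<n] = filter P [0..<n]"
    using assms by (intro filter_cong) auto
  ultimately show ?thesis
    by (simp add: filter_map flip: rev_filter)
qed

text \<open>
  With \<open>a\<close> and \<open>z\<close> the smallest and the largest significant index of the lower half, symmetry gives
  \<open>d0 = 2 * 2 ^ j - 1 - 2 * z\<close>, \<open>d1 = 2 * a + 1\<close>, and the lengths \<open>2 * (2 ^ j - a)\<close> and \<open>2 * z + 2\<close>.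
  Hence, for \<open>j \<ge> 1\<close>, a full block is reported only if \<open>a\<close> and \<open>z\<close> lie on different sides of
  \<open>2 ^ (j - 1)\<close>, and every other block is shorter than the vector.
\<close>

lemma detect_full_cases:
  assumes sym: "\<forall>k<2 ^ (j + 1). y' $ (2 ^ (j + 1) - 1 - k) = y' $ k"
  obtains
    (zero) "result (detect_full \<epsilon> j y') = Index_List []"
  | (full) a z where "\<epsilon> < \<bar>y' $ a\<bar>" "\<epsilon> < \<bar>y' $ z\<bar>" "a \<le> z" "z < 2 ^ j"
      "1 \<le> j \<Longrightarrow> a < 2 ^ (j - 1) \<and> 2 ^ (j - 1) \<le> z"
      "result (detect_full \<epsilon> j y') = One_Block 0 (2 ^ (j + 1))"
  | (middle) a where "0 < a" "a < 2 ^ j"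
      "result (detect_full \<epsilon> j y') = One_Block a (2 ^ (j + 1) - 2 * a)"
  | (boundary) z where "z + 1 < 2 ^ j"
      "result (detect_full \<epsilon> j y') = One_Block (2 ^ (j + 1) - 1 - z) (2 * z + 2)"
proof -
  define H :: nat where "H = 2 ^ j"
  define P where "P k \<longleftrightarrow> \<epsilon> < \<bar>y' $ k\<bar>" for k
  define ts where "ts = filter P [0..<2 * H]"
  define A where "A = filter P [0..<H]"
  have "ts = A @ filter P [H..<2 * H]"
    using upt_add_eq_append[of 0 H H] by (simp add: ts_def A_def mult_2)
  then have ts: "ts = A @ rev (map (\<lambda>k. 2 * H - 1 - k) A)"
    using filter_symmetric[of H P] sym by (simp add: A_def P_def H_def)
  have res: "result (detect_full \<epsilon> j y') = (if ts = [] then Index_List [] else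
     (let K = length ts div 2; t1 = hd ts; tK = ts ! (K - 1); tK1 = ts ! K; t2K = last ts;
       d0 = int tK1 - int tK;
       d1 = (int t1 - int t2K) mod (2 * int H);
       m0 = t2K - t1 + 1;
       m1 = 2 * H - tK1 + tK + 1
      in if d0 = d1 \<or> H < min m0 m1 then One_Block 0 (2 * H)
            else if d0 < d1 then One_Block t1 m0
            else One_Block tK1 m1))"
    by (simp add: detect_full_def Let_def H_def flip: P_def ts_def[unfolded H_def])
  show thesis
  proof (cases "A = []")
    case True
    then show thesis
      using zero res ts by simp
  next
    case False
    define a where "a = hd A"
    define z where "z = last A"
    have mem: "a \<in> set A" "z \<in> set A"
      using False by (simp_all add: a_def z_def)
    then have "P a" "P z" and z: "z < H"
      by (auto simp: A_def)
    have "sorted A"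
      unfolding A_def using sorted_upt by (rule sorted_wrt_filter)
    then have az: "a \<le> z"
      using False unfolding a_def z_def by (cases A) auto
    have K: "length ts div 2 = length A"
      by (simp add: ts)
    have ends: "ts \<noteq> []" "hd ts = a" "ts ! (length A - 1) = z" "ts ! length A = 2 * H - 1 - z"
      "last ts = 2 * H - 1 - a"
      using False
      by (simp_all add: ts a_def z_def nth_append last_conv_nth rev_nth hd_conv_nth)
    \<comment> \<open>The difference is negative, so the residue adds one full period \<open>2 * H\<close>.\<close>
    have d1: "(int a - int (2 * H - 1 - a)) mod (2 * int H) = 2 * int a + 1"
    proof -
      have "int a - int (2 * H - 1 - a) = 2 * int a + 1 + 2 * int H * (- 1)"
        using z az by (simp add: of_nat_diff)
      then show ?thesis
        using z az by (simp only: mod_mult_self2) (simp add: mod_pos_pos_trivial)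
    qed
    have d0: "int (2 * H - 1 - z) - int z = 2 * int H - 1 - 2 * int z"
      using z by (simp add: of_nat_diff)
    have m0: "2 * H - 1 - a - a + 1 = 2 * H - 2 * a" and m1: "2 * H - (2 * H - 1 - z) + z + 1 = 2 * z + 2"
      using z az by auto
    have res': "result (detect_full \<epsilon> j y') =
       (if 2 * int H - 1 - 2 * int z = 2 * int a + 1 \<or> H < min (2 * H - 2 * a) (2 * z + 2)
        then One_Block 0 (2 * H)
        else if 2 * int H - 1 - 2 * int z < 2 * int a + 1 then One_Block a (2 * H - 2 * a)
        else One_Block (2 * H - 1 - z) (2 * z + 2))"
      using ends(1) unfolding res Let_def K ends d0 d1 m0 m1 by simp
    have H2: "2 * H = 2 ^ (j + 1)"
      by (simp add: H_def)
    consider (f) "2 * int H - 1 - 2 * int z = 2 * int a + 1 \<or> H < min (2 * H - 2 * a) (2 * z + 2)"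
      | (m) "\<not> (2 * int H - 1 - 2 * int z = 2 * int a + 1 \<or> H < min (2 * H - 2 * a) (2 * z + 2))"
        "2 * int H - 1 - 2 * int z < 2 * int a + 1"
      | (b) "\<not> (2 * int H - 1 - 2 * int z = 2 * int a + 1 \<or> H < min (2 * H - 2 * a) (2 * z + 2))"
        "2 * int a + 1 < 2 * int H - 1 - 2 * int z"
      by linarith
    then show thesis
    proof cases
      case f
      have "a < 2 ^ (j - 1) \<and> 2 ^ (j - 1) \<le> z" if "1 \<le> j"
      proof -
        define h :: nat where "h = 2 ^ (j - 1)"
        have "H = 2 * h"
          using that by (simp add: H_def h_def flip: power_Suc)
        then have "a < h \<and> h \<le> z"
          using f az z by auto
        then show ?thesis
          by (simp add: h_def)
      qed
      then show thesis
        using full[of a z] f res' H2 az z \<open>P a\<close> \<open>P z\<close> by (simp add: P_def H_def)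
    next
      case m
      then have "result (detect_full \<epsilon> j y') = One_Block a (2 * H - 2 * a)"
        unfolding res' by (simp only: if_True if_False)
      moreover have "0 < a"
        using m z by linarith
      ultimately show thesis
        using middle[of a] az z by (simp add: H_def)
    next
      case b
      then have "\<not> 2 * int H - 1 - 2 * int z < 2 * int a + 1"
        by linarith
      with b(1) have "result (detect_full \<epsilon> j y') = One_Block (2 * H - 1 - z) (2 * z + 2)"
        unfolding res' by (simp only: if_False)
      moreover have "z + 1 < H"
        using b z by linarith
      ultimately show thesis
        using boundary[of z] by (simp add: H_def)
    qed
  qed
qed

section \<open>The reflected signal and its periodizations\<close>

text \<open>
  The whole index range is a periodic interval of length \<open>N\<close>, so the least length exists and
  satisfies its defining property.
\<close>

lemma one_block_support_periodic:
  assumes "one_block_support N x m" "m < N"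
  obtains \<mu> where "1 \<le> m" "\<And>k. k < N \<Longrightarrow> x $ k \<noteq> 0 \<Longrightarrow> \<exists>r<m. k = (\<mu> + r) mod N"
proof -
  let ?Q = "\<lambda>l. 1 \<le> l \<and> (\<exists>\<mu><N. \<forall>k<N. k \<notin> periodic_interval N \<mu> ((\<mu> + l - 1) mod N) \<longrightarrow> x $ k = 0)"
  have "(0 + N - 1) mod N + N - 0 = N - 1 + N"
    using assms(2) by simp
  then have "((0 + N - 1) mod N + N - 0) mod N = N - 1"
    using assms(2) by (simp only: mod_add_self2) simp
  then have "k \<in> periodic_interval N 0 ((0 + N - 1) mod N)" if "k < N" for k
    using that unfolding periodic_interval_def by (auto intro!: exI[of _ k])
  then have "?Q N"
    using assms(2) by (intro conjI exI[of _ 0]) auto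
  then have "?Q m"
    using LeastI[of ?Q] assms(1) unfolding one_block_support_def by blast
  then obtain \<mu> where m: "1 \<le> m" and \<mu>: "\<mu> < N"
    and out: "\<And>k. k < N \<Longrightarrow> k \<notin> periodic_interval N \<mu> ((\<mu> + m - 1) mod N) \<Longrightarrow> x $ k = 0"
    by blast
  have len: "((\<mu> + m - 1) mod N + N - \<mu>) mod N = m - 1"
  proof (cases "\<mu> + m - 1 < N")
    case True
    then have "(\<mu> + m - 1) mod N + N - \<mu> = m - 1 + N"
      using m by simp
    then show ?thesis
      using assms(2) by simp
  next
    case False
    then have "(\<mu> + m - 1) mod N = \<mu> + m - 1 - N"
      using \<mu> assms(2) m by (simp add: mod_if)
    then have "(\<mu> + m - 1) mod N + N - \<mu> = m - 1"
      using m False by simp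
    then show ?thesis
      using assms(2) by simp
  qed
  show thesis
  proof (rule that)
    fix k assume "k < N" "x $ k \<noteq> 0"
    then have "k \<in> periodic_interval N \<mu> ((\<mu> + m - 1) mod N)"
      using out by blast
    then obtain r where "r \<le> m - 1" "k = (\<mu> + r) mod N"
      unfolding periodic_interval_def len by blast
    then show "\<exists>r<m. k = (\<mu> + r) mod N"
      using m by (intro exI[of _ r]) simp
  qed (rule m)
qed

locale sparse_signal =
  fixes J N m :: nat and x y :: "real vec" and \<epsilon> :: real
  assumes J: "2 \<le> J" and N: "N = 2 ^ (J - 1)" and x: "x \<in> carrier_vec N"
    and block: "one_block_support N x m" and m_less: "m < N"
    and y: "y = x @\<^sub>v (counter_identity N *\<^sub>v x)"
    and threshold: "admissible_threshold J y \<epsilon>"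
begin

lemma two_N: "2 * N = 2 ^ J"
  using J by (simp add: N flip: power_Suc)

lemma m_pos: "1 \<le> m"
  using one_block_support_periodic[OF block m_less] by metis

lemma y_symmetric:
  assumes "k < 2 ^ J"
  shows "y $ (2 ^ J - 1 - k) = y $ k"
proof (cases "k < N")
  case True
  then show ?thesis
    using reflected_index[OF x y] two_N by simp
next
  case False
  then have "2 ^ J - 1 - k < N" "2 * N - 1 - (2 ^ J - 1 - k) = k"
    using assms two_N by auto
  then show ?thesis
    using reflected_index[OF x y, of "2 ^ J - 1 - k"] by simp
qed

definition support :: "nat set" where
  "support = {k. k < 2 ^ J \<and> y $ k \<noteq> 0}"

text \<open>
  The support of \<open>x\<close> lies in a periodic block of length \<open>m\<close>. As \<open>2 ^ i\<close> divides \<open>N\<close>, folding forgets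
  the wrap-around of this block and the reflected copy in \<open>y\<close>; the Lipschitz property does the rest.
\<close>

lemma support_close:
  assumes "k \<in> support" "l \<in> support" "i < J"
  shows "fold_index (2 ^ i) k < fold_index (2 ^ i) l + m"
proof -
  obtain \<mu> where \<mu>: "\<And>k. k < N \<Longrightarrow> x $ k \<noteq> 0 \<Longrightarrow> \<exists>r<m. k = (\<mu> + r) mod N"
    using one_block_support_periodic[OF block m_less] by metis
  have dvd: "2 ^ i dvd N"
    using assms(3) by (auto simp: N intro: le_imp_power_dvd)
  have fold: "\<exists>r<m. fold_index (2 ^ i) k = fold_index (2 ^ i) (\<mu> + r)" if k: "k \<in> support" for k
  proof -
    define k' where "k' = (if k < N then k else 2 * N - 1 - k)"
    have k': "k' < N" and "k = k' \<or> k = 2 * N - 1 - k'"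
      using k two_N by (auto simp: k'_def support_def)
    then have "x $ k' \<noteq> 0" and "fold_index (2 ^ i) k = fold_index (2 ^ i) k'"
      using k reflected_index[OF x y k'] fold_index_reflect[OF dvd_mult[OF dvd], of k' 2]
      by (auto simp: support_def)
    moreover obtain r where "r < m" "k' = (\<mu> + r) mod N"
      using \<mu> k' \<open>x $ k' \<noteq> 0\<close> by blast
    ultimately show ?thesis
      using fold_index_mod[OF dvd] by auto
  qed
  show ?thesis
    using fold[OF assms(1)] fold[OF assms(2)] fold_index_close[of "2 ^ i"] by auto
qed

text \<open>
  The folded support has points on both sides of the midpoint \<open>2 ^ (i - 2)\<close> of the lower half of the
  vector of length \<open>2 ^ i\<close>. This is what the detection of a full block reveals.
\<close>

definition straddles :: "nat \<Rightarrow> bool" where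
  "straddles i \<longleftrightarrow> (\<exists>k \<in> support. fold_index (2 ^ i) k < 2 ^ (i - 2)) \<and>
     (\<exists>k \<in> support. 2 ^ (i - 2) \<le> fold_index (2 ^ i) k)"

text \<open>
  Put \<open>2 ^ j = 4 * n\<close>. If the support straddles at level \<open>j + 1\<close>, its folded indices cluster within
  \<open>m\<close> of \<open>2 * n\<close>. Passing to level \<open>j\<close> folds once more, at \<open>2 * n\<close>, and moves the cluster to the top
  of \<open>{0..<2 * n}\<close>. To straddle \<open>n\<close> there as well, it must be longer than \<open>n\<close>.
\<close>

lemma straddles_twice:
  assumes "2 \<le> j" "j + 1 < J" "straddles j" "straddles (j + 1)"
  shows "2 ^ (j + 1) < 8 * m"
proof -
  define n :: nat where "n = 2 ^ (j - 2)"
  obtain i where "j = i + 2"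
    using assms(1) le_Suc_ex[of 2 j] by auto
  then have pow: "2 ^ j = 4 * n" "2 ^ (j + 1) = 2 * (4 * n)" "2 ^ (j + 1 - 2) = 2 * n" and n: "0 < n"
    by (simp_all add: n_def)
  obtain c where c: "c \<in> support" "fold_index (4 * n) c < n"
    using assms(3) by (auto simp: straddles_def pow n_def[symmetric])
  obtain k l where kl: "k \<in> support" "fold_index (2 * (4 * n)) k < 2 * n"
    "l \<in> support" "2 * n \<le> fold_index (2 * (4 * n)) l"
    using assms(4) unfolding straddles_def pow by blast
  define t where "t = fold_index (2 * (4 * n)) c"
  have "t < 4 * n" "min t (4 * n - 1 - t) < n"
    using c fold_index_double[of "4 * n" c] n by (simp_all add: t_def)
  moreover have "fold_index (2 * (4 * n)) l < t + m" "t < fold_index (2 * (4 * n)) k + m"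
    using support_close[OF kl(3) c(1) assms(2)] support_close[OF c(1) kl(1) assms(2)]
    unfolding t_def pow by simp_all
  ultimately have "n < m"
    using kl by linarith
  then show ?thesis
    unfolding pow by simp
qed

text \<open>
  A nonzero entry of a periodization comes from a nonzero entry of \<open>y\<close>, for which the threshold
  condition speaks. So thresholding never changes an exact periodization.
\<close>

lemma periodization_nonzero:
  assumes "i \<le> J" "a < 2 ^ i" "periodization J i y $ a \<noteq> 0"
  shows "\<exists>k \<in> support. k mod 2 ^ i = a" "\<epsilon> < \<bar>periodization J i y $ a\<bar>"
proof -
  have "(\<Sum>l<2 ^ (J - i). y $ (a + 2 ^ i * l)) \<noteq> 0"
    using assms by (simp add: periodization_def)
  then obtain l where l: "l < 2 ^ (J - i)" "y $ (a + 2 ^ i * l) \<noteq> 0"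
    by (meson lessThan_iff sum.not_neutral_contains_not_neutral)
  have "a + 2 ^ i * l < 2 ^ i * (l + 1)"
    using assms by simp
  also have "\<dots> \<le> 2 ^ i * 2 ^ (J - i)"
    using l by (intro mult_left_mono) auto
  also have "\<dots> = 2 ^ J"
    using assms by (simp flip: power_add)
  finally have k: "a + 2 ^ i * l < 2 ^ J" .
  show "\<exists>k \<in> support. k mod 2 ^ i = a"
    using k l assms by (intro bexI[of _ "a + 2 ^ i * l"]) (auto simp: support_def)
  have "\<bar>periodization J i y $ ((a + 2 ^ i * l) mod 2 ^ i)\<bar> > \<epsilon>"
    using threshold k l assms(1) unfolding admissible_threshold_def by blast
  then show "\<epsilon> < \<bar>periodization J i y $ a\<bar>"
    using assms by simp
qed

lemma periodization_symmetric:
  assumes "i \<le> J" "a < 2 ^ i"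
  shows "periodization J i y $ (2 ^ i - 1 - a) = periodization J i y $ a"
proof -
  let ?n = "2 ^ (J - i) :: nat"
  have J': "2 ^ J = 2 ^ i * ?n"
    using assms by (simp flip: power_add)
  have "(\<Sum>l<?n. y $ (2 ^ i - 1 - a + 2 ^ i * l)) = (\<Sum>l<?n. y $ (2 ^ i - 1 - a + 2 ^ i * (?n - Suc l)))"
    by (rule sum.nat_diff_reindex[symmetric])
  also have "\<dots> = (\<Sum>l<?n. y $ (a + 2 ^ i * l))"
  proof (rule sum.cong[OF refl])
    fix l assume "l \<in> {..<?n}"
    then obtain d where d: "?n = l + d + 1"
      using less_imp_Suc_add[of l ?n] by auto
    have idx: "2 ^ i - 1 - a + 2 ^ i * (?n - Suc l) = 2 ^ J - 1 - (a + 2 ^ i * l)"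
      using assms(2) unfolding J' d by (simp add: algebra_simps)
    have "a + 2 ^ i * l < 2 ^ J"
      using assms(2) unfolding J' d by (simp add: algebra_simps)
    then show "y $ (2 ^ i - 1 - a + 2 ^ i * (?n - Suc l)) = y $ (a + 2 ^ i * l)"
      unfolding idx by (rule y_symmetric)
  qed
  finally show ?thesis
    using assms by (simp add: periodization_def)
qed

text \<open>
  The IFFT recovers the twisted difference of the two halves of the next periodization, whose sum
  is the current periodization. Half the sum of both is the first half, and symmetry yields the
  second one.
\<close>

lemma result_step_full:
  assumes ifft: "is_IFFT ifft" and j: "j < J"
  shows "result (step_full ifft \<epsilon> J (cosine_mat_II N *\<^sub>v x) j (periodization J j y))
    = periodization J (j + 1) y"
proof -
  define p where "p = periodization J (j + 1) y"
  define v where "v = vec (2 ^ j) (\<lambda>k. dft (2 ^ (j + 1)) p (2 * k + 1))"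
  define d where "d = vec (2 ^ j)
    (\<lambda>l. omega (2 ^ (j + 1)) ^ l * complex_of_real (p $ l - p $ (l + 2 ^ j)))"
  have J': "J - j - 1 = J - (j + 1)"
    by simp
  have sample: "result (yhat N (cosine_mat_II N *\<^sub>v x) (2 ^ (J - j - 1) * (2 * k + 1)))
      = dft (2 ^ (j + 1)) p (2 * k + 1)" if "k < 2 ^ j" for k
  proof -
    have "2 ^ (J - j - 1) * (2 * k + 1) < 2 ^ (J - j - 1) * 2 ^ (j + 1)"
      using that by (intro mult_strict_left_mono) auto
    also have "\<dots> = 2 * N"
      using j unfolding two_N power_add[symmetric] by simp
    finally show ?thesis
      using dft_periodization[of "j + 1" J y "2 * k + 1"] j
      unfolding p_def by (simp only: result_yhat[OF x y] two_N J' Suc_eq_plus1[symmetric] Suc_leI)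
  qed
  have v: "v \<in> carrier_vec (2 ^ j)"
    by (simp add: v_def)
  have samples: "vec (2 ^ j) (\<lambda>k. result (yhat N (cosine_mat_II N *\<^sub>v x) (2 ^ (J - j - 1) * (2 * k + 1)))) = v"
    unfolding v_def by (intro eq_vecI) (simp_all only: dim_vec index_vec sample)
  have Fd: "fourier_mat (2 ^ j) *\<^sub>v d = v"
  proof (intro eq_vecI)
    fix k assume "k < dim_vec v"
    then have k: "k < 2 ^ j"
      by (simp add: v_def)
    then have "(fourier_mat (2 ^ j) *\<^sub>v d) $ k = (\<Sum>l<2 ^ j. omega (2 ^ j) ^ (k * l) * d $ l)"
      by (intro fourier_mat_mult_index) (auto simp: d_def)
    also have "\<dots> = v $ k"
      unfolding v_def index_vec[OF k] dft_odd by (intro sum.cong refl) (simp add: d_def)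
    finally show "(fourier_mat (2 ^ j) *\<^sub>v d) $ k = v $ k" .
  qed (simp add: v_def fourier_mat_def)
  have Fv: "fourier_mat (2 ^ j) *\<^sub>v result (ifft v) = v" "result (ifft v) \<in> carrier_vec (2 ^ j)"
    using ifft v unfolding is_IFFT_def by blast+
  have inv: "result (ifft v) = d"
    by (rule fourier_mat_inj[OF Fv(2) _ trans[OF Fv(1) Fd[symmetric]]]) (simp add: d_def)
  have entry: "result (half_entry \<epsilon> (periodization J j y $ l)
      (omega (2 ^ (j + 1)) powi (- int l) * d $ l)) = p $ l" if l: "l < 2 ^ j" for l
  proof -
    have "omega (2 ^ (j + 1)) powi (- int l) * d $ l = of_real (p $ l - p $ (l + 2 ^ j))"
      using l by (simp add: d_def power_int_minus)
    moreover have "1 / 2 * (periodization J j y $ l + (p $ l - p $ (l + 2 ^ j))) = p $ l"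
      unfolding periodization_halves[OF j l] p_def by simp
    moreover have "p $ l = 0" if "\<bar>p $ l\<bar> \<le> \<epsilon>"
      using that periodization_nonzero(2)[of "j + 1" l] j l by (force simp: p_def)
    ultimately show ?thesis
      by (simp add: half_entry_def)
  qed
  define w where "w = vec (2 ^ j) (\<lambda>l. p $ l)"
  have res: "result (step_full ifft \<epsilon> J (cosine_mat_II N *\<^sub>v x) j (periodization J j y))
      = w @\<^sub>v (counter_identity (2 ^ j) *\<^sub>v w)"
  proof -
    have "vec (2 ^ j) (\<lambda>l. result (half_entry \<epsilon> (periodization J j y $ l)
      (omega (2 ^ (j + 1)) powi (- int l) * d $ l))) = w"
      unfolding w_def by (intro eq_vecI) (simp_all only: dim_vec index_vec entry)
    then show ?thesis
      unfolding step_full_def twiddle_def bind_comp_simps result_prims result_vecM N[symmetric]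
        samples inv by simp
  qed
  also have "\<dots> = p"
  proof (intro eq_vecI)
    fix i assume "i < dim_vec p"
    then have i: "i < 2 * 2 ^ j"
      by (simp add: p_def periodization_def)
    have w: "w \<in> carrier_vec (2 ^ j)"
      by (simp add: w_def)
    show "(w @\<^sub>v (counter_identity (2 ^ j) *\<^sub>v w)) $ i = p $ i"
    proof (cases "i < 2 ^ j")
      case True
      then show ?thesis
        using reflected_index(1)[OF w refl] by (simp add: w_def)
    next
      case False
      then have l: "2 * 2 ^ j - 1 - i < 2 ^ j" "2 * 2 ^ j - 1 - (2 * 2 ^ j - 1 - i) = i"
        using i by auto
      have "(w @\<^sub>v (counter_identity (2 ^ j) *\<^sub>v w)) $ i = p $ (2 * 2 ^ j - 1 - i)"
        using reflected_index(2)[OF w refl l(1)] l by (simp add: w_def)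
      also have "\<dots> = p $ i"
        using periodization_symmetric[of "j + 1" i] i j by (simp add: p_def)
      finally show ?thesis .
    qed
  qed (simp add: w_def p_def periodization_def counter_identity_def)
  finally show ?thesis
    by (simp add: p_def)
qed

end

section \<open>The states of the sparse FFT\<close>

context sparse_signal
begin

text \<open>
  A block that is not full is only required to be centered, around the middle in the first and
  around the boundary in the second alternative; the cost of the later levels depends on its
  length alone, so nothing is said about the vector. Only as long as the block is full, the
  detected length depends on the computed entries, and they have to be correct. The constant 16
  arises because the first block that is not full lies in a vector twice as long as the last full
  block, which is shorter than \<open>8 * m\<close>.
\<close>

fun invar :: "nat \<Rightarrow> real vec \<times> supp \<Rightarrow> bool" where
  "invar j (v, One_Block \<mu> p) \<longleftrightarrow> 1 \<le> p \<and> p \<le> 16 * m \<and>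
     (if p = 2 ^ j then \<mu> = 0 \<and> v = periodization J j y \<and> 2 ^ j < 8 * m \<and> (2 \<le> j \<longrightarrow> straddles j)
      else p < 2 ^ j \<and> \<mu> < 2 ^ j \<and> (if 2 * \<mu> < 2 ^ j then p = 2 ^ j - 2 * \<mu> else p = 2 * (2 ^ j - \<mu>)))"
| "invar j (v, Two_Blocks \<mu> n) \<longleftrightarrow> 1 \<le> n \<and> n \<le> 2 ^ j \<and> n \<le> 16 * m"
| "invar j (v, Index_List ts) \<longleftrightarrow> True"

lemma invar_size: "invar j (v, S) \<Longrightarrow> supp_size S \<le> min (2 ^ j) (16 * m)"
  by (cases S) (auto split: if_splits)

lemma invar_start:
  "invar 0 (vec 1 (\<lambda>_. Re (result (yhat N (cosine_mat_II N *\<^sub>v x) 0))), One_Block 0 1)"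
proof -
  have "result (yhat N (cosine_mat_II N *\<^sub>v x) 0) = dft (2 ^ J) y 0"
    using result_yhat[OF x y, of 0] m_less by (simp add: two_N)
  also have "\<dots> = complex_of_real (\<Sum>l<2 ^ J. y $ l)"
    by (simp add: dft_def)
  finally have "vec 1 (\<lambda>_. Re (result (yhat N (cosine_mat_II N *\<^sub>v x) 0))) = periodization J 0 y"
    by (intro eq_vecI) (simp_all add: periodization_def)
  then show ?thesis
    using m_pos by simp
qed

text \<open>
  If the block is full again, the support straddles at level \<open>j + 1\<close>; it did so at level \<open>j\<close>, unless
  \<open>j\<close> is too small for this to matter. So the vector is still shorter than \<open>8 * m\<close>.
\<close>

lemma invar_full_step:
  assumes "j + 1 < J" "2 ^ j < 8 * m" "2 \<le> j \<longrightarrow> straddles j"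
  shows "invar (j + 1) (periodization J (j + 1) y, result (detect_full \<epsilon> j (periodization J (j + 1) y)))"
    (is "invar _ (?y, _)")
proof -
  have sym: "\<forall>k<2 ^ (j + 1). ?y $ (2 ^ (j + 1) - 1 - k) = ?y $ k"
    using periodization_symmetric[of "j + 1"] assms(1) by simp
  from sym show ?thesis
  proof (cases rule: detect_full_cases[where \<epsilon> = \<epsilon>])
    case zero
    then show ?thesis
      by simp
  next
    case (full a z)
    have fold: "\<exists>k \<in> support. fold_index (2 ^ (j + 1)) k = b" if b: "b < 2 ^ j" "\<epsilon> < \<bar>?y $ b\<bar>" for b
    proof -
      have "0 < \<epsilon>"
        using threshold by (simp add: admissible_threshold_def)
      then obtain k where "k \<in> support" "k mod 2 ^ (j + 1) = b"
        using periodization_nonzero(1)[of "j + 1" b] b assms(1) by fastforce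
      then show ?thesis
        using b by (intro bexI[of _ k]) (auto simp: fold_index_def)
    qed
    have "straddles (j + 1)" if "2 \<le> j + 1"
    proof -
      have "a < 2 ^ (j - 1)" "2 ^ (j - 1) \<le> z" "j + 1 - 2 = j - 1"
        using full(5) that by auto
      moreover have "a < 2 ^ j"
        using full by simp
      ultimately show ?thesis
        unfolding straddles_def using fold[of a] fold[of z] full(1,2,4) by auto
    qed
    moreover have "2 ^ (j + 1) < 8 * m"
    proof (cases "2 \<le> j")
      case True
      then show ?thesis
        using straddles_twice assms calculation by simp
    next
      case False
      then have "j = 0 \<or> j = 1"
        by linarith
      then show ?thesis
        using m_pos by auto
    qed
    ultimately show ?thesis
      using full by simp
  next
    case (middle a)
    then have "1 \<le> (2::nat) ^ (j + 1) - 2 * a" "(2::nat) ^ (j + 1) - 2 * a < 2 ^ (j + 1)"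
      "2 ^ (j + 1) - 2 * a \<le> 16 * m"
      using assms(2) by auto
    then show ?thesis
      using middle by simp
  next
    case (boundary z)
    then show ?thesis
      using assms(2) by simp
  qed
qed

lemma detect_middle_cases:
  assumes "2 * \<mu> < 2 ^ j"
  obtains "result (detect_middle \<epsilon> j \<mu> y') = Index_List []"
  | \<nu> n where "result (detect_middle \<epsilon> j \<mu> y') = Two_Blocks \<nu> n" "1 \<le> n" "n \<le> 2 ^ j - 2 * \<mu>"
proof -
  define ts where "ts = filter (\<lambda>k. \<epsilon> < \<bar>y' $ k\<bar>) [\<mu>..<2 ^ j - \<mu>]"
  have res: "result (detect_middle \<epsilon> j \<mu> y')
      = (if ts = [] then Index_List [] else Two_Blocks (hd ts) (last ts - hd ts + 1))"
    by (simp add: detect_middle_def ts_def)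
  show thesis
  proof (cases "ts = []")
    case True
    then show thesis
      using that(1) res by simp
  next
    case False
    then have "hd ts \<in> set ts" "last ts \<in> set ts"
      by simp_all
    then have "\<mu> \<le> hd ts" "last ts < 2 ^ j - \<mu>"
      by (auto simp: ts_def)
    then show thesis
      using that(2)[of "hd ts" "last ts - hd ts + 1"] res False assms by simp
  qed
qed

lemma result_detect_boundary:
  "\<exists>\<mu>'. result (detect_boundary j \<mu> p y') = One_Block \<mu>' p \<and> (\<mu>' = \<mu> \<or> \<mu>' = 2 ^ j + \<mu>)"
  by (auto simp: detect_boundary_def)

text \<open>
  Doubling the vector length turns a block around the boundary, kept in place, into one around
  the middle; shifted by \<open>2 ^ j\<close> it stays around the boundary. Its length is kept either way.
\<close>

lemma invar_detect_block:
  assumes "invar j (v, One_Block \<mu> p)" "p \<noteq> 2 ^ j"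
  shows "invar (j + 1) (y', result (detect_one \<epsilon> J j \<mu> p y'))"
proof (cases "2 * \<mu> < 2 ^ j")
  case True
  then have "\<mu> \<le> 2 ^ j - 1 - \<mu>"
    by linarith
  then have "result (detect_one \<epsilon> J j \<mu> p y') = result (detect_middle \<epsilon> j \<mu> y')"
    using assms by (simp add: detect_one_def)
  then show ?thesis
    using assms True by (cases rule: detect_middle_cases[OF True, where y' = y']) auto
next
  case False
  then have mid: "\<not> \<mu> \<le> 2 ^ j - 1 - \<mu>"
    using assms by auto
  show ?thesis
  proof (cases "j = J - 1")
    case True
    then show ?thesis
      using mid by (simp add: detect_one_def)
  next
    case last: False
    obtain \<mu>' where \<mu>': "result (detect_boundary j \<mu> p y') = One_Block \<mu>' p" "\<mu>' = \<mu> \<or> \<mu>' = 2 ^ j + \<mu>"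
      using result_detect_boundary by blast
    have res: "result (detect_one \<epsilon> J j \<mu> p y') = One_Block \<mu>' p"
      unfolding detect_one_def using mid last assms(2) \<mu>'(1) by simp
    have size: "1 \<le> p" "p \<le> 16 * m" "p < 2 ^ j" "\<mu> < 2 ^ j" "p = 2 * (2 ^ j - \<mu>)"
      using assms False by simp_all
    show ?thesis
      using \<mu>'(2)
    proof
      assume "\<mu>' = \<mu>"
      then show ?thesis
        using size unfolding res by simp
    next
      assume "\<mu>' = 2 ^ j + \<mu>"
      then show ?thesis
        using size unfolding res by simp
    qed
  qed
qed

lemma invar_level:
  assumes ifft: "is_IFFT ifft" and j: "j < J" and invar: "invar j (v, S)"
  shows "invar (j + 1) (result (level ifft \<epsilon> J (cosine_mat_II N *\<^sub>v x) j (v, S)))"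
proof (cases S)
  case (One_Block \<mu> p)
  show ?thesis
  proof (cases "p = 2 ^ j")
    case full: True
    have "result (level ifft \<epsilon> J (cosine_mat_II N *\<^sub>v x) j (v, S))
        = (periodization J (j + 1) y,
           result (detect_one \<epsilon> J j 0 (2 ^ j) (periodization J (j + 1) y)))"
      using invar result_step_full[OF ifft j] by (simp add: One_Block full)
    moreover have "invar (j + 1) (periodization J (j + 1) y,
        result (detect_one \<epsilon> J j 0 (2 ^ j) (periodization J (j + 1) y)))"
      using invar_full_step[of j] invar j by (auto simp: detect_one_def One_Block full)
    ultimately show ?thesis
      by simp
  next
    case False
    then show ?thesis
      using invar_detect_block[of j v \<mu> p] invar by (simp add: One_Block)
  qed
next
  case (Two_Blocks \<mu> n)
  then show ?thesis
    using invar by (auto split: prod.split)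
next
  case (Index_List ts)
  then show ?thesis
    by simp
qed

text \<open>
  A transform of length \<open>2 ^ e\<close> only occurs with \<open>2 ^ e \<le> 2 * p \<le> 32 * m\<close>, so its logarithm is at most
  \<open>6 * max 1 q\<close>. All other work is linear in the size of the state.
\<close>

lemma costs_level:
  assumes ifft: "\<And>e v. v \<in> carrier_vec (2 ^ e) \<Longrightarrow> costs (K * (2 ^ e * max 1 e)) 0 (ifft v)"
    and q: "m < 2 ^ (q + 1)" and invar: "invar j (v, S)"
  shows "costs ((51 + 12 * K) * max 1 q * supp_size S) (2 * supp_size S)
    (level ifft \<epsilon> J xhat j (v, S))"
proof (cases S)
  case (One_Block \<mu> p)
  have p: "1 \<le> p" "p \<le> 16 * m"
    using invar by (simp_all add: One_Block)
  have step: "1 + 17 * 2 ^ e + K * (2 ^ e * max 1 e) \<le> (35 + 12 * K) * max 1 q * p"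
    if e: "2 ^ e \<le> 2 * p" for e
  proof -
    \<comment> \<open>\<open>32 * m < 2 ^ 5 * 2 ^ (q + 1)\<close>\<close>
    have "(2::nat) ^ e < 2 ^ (q + 6)"
      using e p q by (simp add: power_add)
    then have "e < q + 6"
      using power_less_imp_less_exp[of 2 e "q + 6"] by simp
    then have "max 1 e \<le> 6 * max 1 q"
      by auto
    then have "2 ^ e * max 1 e \<le> 2 * p * (6 * max 1 q)"
      using e by (rule mult_le_mono[rotated])
    then have "K * (2 ^ e * max 1 e) \<le> K * (2 * p * (6 * max 1 q))"
      by (rule mult_le_mono2)
    moreover have "1 + 17 * 2 ^ e \<le> 35 * p"
      using e p by linarith
    moreover have "35 * p \<le> 35 * (max 1 q * p)"
      by (cases q) auto
    ultimately have "1 + 17 * 2 ^ e + K * (2 ^ e * max 1 e)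
        \<le> 35 * (max 1 q * p) + K * (2 * p * (6 * max 1 q))"
      by linarith
    also have "\<dots> = (35 + 12 * K) * max 1 q * p"
      by (simp add: algebra_simps)
    finally show ?thesis .
  qed
  define step_comp where "step_comp = (if 2 ^ j < 2 * p then step_full ifft \<epsilon> J xhat j v
      else step_window ifft \<epsilon> J xhat j \<mu> p v)"
  have compute: "costs ((35 + 12 * K) * max 1 q * p) (2 * p) step_comp"
  proof (cases "2 ^ j < 2 * p")
    case True
    then have bound: "15 * 2 ^ j + K * (2 ^ j * max 1 j) \<le> (35 + 12 * K) * max 1 q * p"
      by (intro order.trans[OF _ step[of j]] add_mono) simp_all
    show ?thesis
      unfolding step_comp_def if_P[OF True]
      by (rule costs_mono[OF costs_step_full[OF ifft] bound]) (use True in auto)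
  next
    case False
    show ?thesis
      unfolding step_comp_def if_not_P[OF False]
      by (rule costs_mono[OF costs_step_window[OF ifft] step])
        (simp_all add: pow_window_length[OF p(1)])
  qed
  have detect: "costs (16 * p) 0 (detect_one \<epsilon> J j \<mu> p y')" for y'
    using invar by (intro costs_detect_one) (auto simp: One_Block split: if_splits)
  have total: "costs ((35 + 12 * K) * max 1 q * p + (16 * p + 0)) (2 * p + (0 + 0))
      (level ifft \<epsilon> J xhat j (v, S))"
    unfolding One_Block level.simps step_comp_def[symmetric]
    by (rule costs_bind compute detect costs_prims(1))+
  have "16 * p \<le> 16 * (max 1 q * p)"
    by (cases q) auto
  then have "(35 + 12 * K) * max 1 q * p + (16 * p + 0) \<le> (35 + 12 * K) * max 1 q * p + 16 * (max 1 q * p)"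
    by simp
  also have "\<dots> = (51 + 12 * K) * max 1 q * p"
    by (simp only: mult.assoc flip: distrib_right) simp
  finally show ?thesis
    by (intro costs_mono[OF total]) (simp_all add: One_Block)
next
  case (Two_Blocks \<mu> n)
  have n: "1 \<le> n"
    using invar by (simp add: Two_Blocks)
  have next_start: "costs 2 0 (case r of (y', c) \<Rightarrow>
      do { \<mu>' \<leftarrow> (if c then ret \<mu> else do { charge 2; ret (2 ^ j - n - \<mu>) });
        ret (y', Two_Blocks \<mu>' n) })" for r :: "real vec \<times> bool"
    by (simp add: costs_def charge_def ret_def split: prod.split)
  have "26 * n + 8 \<le> 34 * n"
    using n by simp
  also have "\<dots> \<le> (51 + 12 * K) * max 1 q * n"
    using mult_le_mono[of 34 "51 + 12 * K" 1 "max 1 q"] by (intro mult_le_mono1) simp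
  finally have bound: "26 * n + 8 \<le> (51 + 12 * K) * max 1 q * n" .
  have "costs (26 * n + 6 + 2) (2 * n + 0) (level ifft \<epsilon> J xhat j (v, S))"
    unfolding Two_Blocks level.simps by (rule costs_bind costs_step_two next_start)+
  then show ?thesis
    by (rule costs_mono) (use bound in \<open>simp_all add: Two_Blocks\<close>)
next
  case (Index_List ts)
  then show ?thesis
    by (simp add: costs_def ret_def)
qed

end

section \<open>Summation over the levels\<close>

lemma costs_foldM_invariant:
  assumes "I a s" "a \<le> b"
    and "\<And>j s. a \<le> j \<Longrightarrow> j < b \<Longrightarrow> I j s \<Longrightarrow> I (Suc j) (result (f j s)) \<and> costs (u j) (v j) (f j s)"
  shows "costs (sum u {a..<b}) (sum v {a..<b}) (foldM f [a..<b] s)"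
  using assms
proof (induction "b - a" arbitrary: a s)
  case 0
  then show ?case
    by (simp add: costs_prims)
next
  case (Suc n)
  then have less: "a < b"
    by simp
  have step: "I (Suc a) (result (f a s)) \<and> costs (u a) (v a) (f a s)"
    using Suc.prems less by simp
  have "costs (sum u {Suc a..<b}) (sum v {Suc a..<b}) (foldM f [Suc a..<b] (result (f a s)))"
    by (rule Suc.hyps(1)) (use Suc step less in auto)
  then show ?case
    using step less by (simp add: costs_bind upt_rec[of a b] sum.atLeast_Suc_lessThan)
qed

text \<open>
  The levels below \<open>q\<close> form a geometric sum; each of the remaining ones costs at most \<open>16 * m\<close>.
\<close>

lemma sum_min_pow:
  assumes "2 ^ q \<le> m" "q \<le> J"
  shows "(\<Sum>j = 0..<J. min (2 ^ j) (16 * m)) \<le> m + 16 * m * (J - q)"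
proof -
  have "(\<Sum>j = 0..<J. min (2 ^ j) (16 * m))
      = (\<Sum>j = 0..<q. min (2 ^ j) (16 * m)) + (\<Sum>j = q..<J. min (2 ^ j) (16 * m))"
    using assms(2) by (simp add: sum.atLeastLessThan_concat)
  also have "\<dots> \<le> (\<Sum>j = 0..<q. 2 ^ j) + (\<Sum>j = q..<J. 16 * m)"
    by (intro add_mono sum_mono) auto
  also have "(\<Sum>j = 0..<q. 2 ^ j) \<le> m"
    using assms(1) sum_power2[of q] by simp
  finally show ?thesis
    by (simp add: mult.commute)
qed

lemma (in sparse_signal) costs_sparse_DCT:
  assumes ifft: "is_IFFT ifft"
    and K: "\<And>e v. v \<in> carrier_vec (2 ^ e) \<Longrightarrow> costs (K * (2 ^ e * max 1 e)) 0 (ifft v)"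
    and q: "2 ^ q \<le> m" "m < 2 ^ (q + 1)"
  defines "W \<equiv> m + 16 * m * (J - q)"
  shows "costs (8 + (51 + 12 * K) * max 1 q * W) (1 + 2 * W)
    (sparse_DCT ifft \<epsilon> J (cosine_mat_II N *\<^sub>v x))"
proof -
  let ?A = "(51 + 12 * K) * max 1 q" and ?xhat = "cosine_mat_II N *\<^sub>v x"
  let ?w = "\<lambda>j. min (2 ^ j) (16 * m)"
  have "(2::nat) ^ q < 2 ^ (J - 1)"
    using q(1) m_less N by linarith
  then have "q \<le> J"
    by simp
  then have W: "sum ?w {0..<J} \<le> W"
    using sum_min_pow q(1) by (simp add: W_def)
  have levels: "costs (\<Sum>j = 0..<J. ?A * ?w j) (\<Sum>j = 0..<J. 2 * ?w j)
      (foldM (level ifft \<epsilon> J ?xhat) [0..<J] (vec 1 (\<lambda>_. Re (result (yhat N ?xhat 0))), One_Block 0 1))"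
  proof (rule costs_foldM_invariant[where I = invar])
    fix j and s :: "real vec \<times> supp"
    assume j: "j < J" and invar: "invar j s"
    obtain v S where s: "s = (v, S)"
      by (cases s)
    have size: "supp_size S \<le> ?w j"
      using invar_size invar unfolding s .
    show "invar (Suc j) (result (level ifft \<epsilon> J ?xhat j s)) \<and>
        costs (?A * ?w j) (2 * ?w j) (level ifft \<epsilon> J ?xhat j s)"
      using invar_level[OF ifft j] costs_mono[OF costs_level[OF K q(2)]] invar size
      unfolding s by (simp del: invar.simps level.simps min.bounded_iff)
  qed (use invar_start in simp_all)
  have "costs (8 + ((\<Sum>j = 0..<J. ?A * ?w j) + 0)) (1 + ((\<Sum>j = 0..<J. 2 * ?w j) + 0))
      (sparse_FFT ifft \<epsilon> J ?xhat)"
    unfolding sparse_FFT_def N[symmetric] case_prod_beta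
    by (rule costs_bind costs_yhat levels costs_prims(1))+
  then have "costs (8 + ?A * sum ?w {0..<J}) (1 + 2 * sum ?w {0..<J}) (sparse_DCT ifft \<epsilon> J ?xhat)"
    unfolding sparse_DCT_def using costs_bind[OF _ costs_prims(1)]
    by (fastforce simp flip: sum_distrib_left)
  then show ?thesis
    by (rule costs_mono) (use W in auto)
qed

theorem theorem5p2:
  fixes ifft :: "complex vec \<Rightarrow> complex vec comp"
  assumes "is_IFFT ifft"
  shows "\<exists>C::real. \<forall>(J::nat) (N::nat) (m::nat) (x::real vec) (y::real vec) (\<epsilon>::real).
    2 \<le> J \<longrightarrow> N = 2 ^ (J - 1) \<longrightarrow>
    x \<in> carrier_vec N \<longrightarrow> one_block_support N x m \<longrightarrow> m < N \<longrightarrow>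
    y = x @\<^sub>v (counter_identity N *\<^sub>v x) \<longrightarrow>
    non_cancellation J y \<longrightarrow> admissible_threshold J y \<epsilon> \<longrightarrow>
    (let run = sparse_DCT ifft \<epsilon> J (cosine_mat_II N *\<^sub>v x) in
       real (ops run) \<le> C * (real m * max 1 (log 2 (real m)) * log 2 (2 * real N / real m)) \<and>
       real (card (set (samples run))) \<le> C * (real m * log 2 (2 * real N / real m)))"
proof -
  obtain K where K: "\<And>e v. v \<in> carrier_vec (2 ^ e) \<Longrightarrow> costs (K * (2 ^ e * max 1 e)) 0 (ifft v)"
    using IFFT_costs[OF assms] by metis
  define A where "A = real (51 + 12 * K)"
  show ?thesis
  proof (intro exI[of _ "8 + 33 * A"] allI impI)
    fix J N m :: nat and x y :: "real vec" and \<epsilon> :: real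
    assume "2 \<le> J" "N = 2 ^ (J - 1)" "x \<in> carrier_vec N" "one_block_support N x m" "m < N"
      "y = x @\<^sub>v (counter_identity N *\<^sub>v x)" "admissible_threshold J y \<epsilon>"
    then interpret sparse_signal J N m x y \<epsilon>
      by unfold_locales
    let ?l = "log 2 (2 * real N / real m)" and ?Q = "max 1 (log 2 (real m))"
    define run where "run = sparse_DCT ifft \<epsilon> J (cosine_mat_II N *\<^sub>v x)"
    obtain q where q: "2 ^ q \<le> m" "m < 2 ^ (q + 1)"
      using ex_power_ivl1[of 2 m] m_pos by auto
    define W where "W = m + 16 * m * (J - q)"
    have cost: "ops run \<le> 8 + (51 + 12 * K) * max 1 q * W" "length (samples run) \<le> 1 + 2 * W"
      using costs_sparse_DCT[OF assms K q] by (simp_all add: costs_def run_def W_def)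
    have "real (2 ^ q) \<le> real m"
      using q(1) by (rule of_nat_mono)
    then have log_m: "real q \<le> log 2 (real m)"
      using m_pos by (simp add: le_log_iff powr_realpow)
    have "real m < real (2 ^ (q + 1))"
      using q(2) by (simp only: of_nat_less_iff)
    then have m_log: "log 2 (real m) < real q + 1"
      using m_pos by (simp add: log_less_iff powr_add powr_realpow)
    have "2 * real N = 2 ^ J"
      using arg_cong[OF two_N, of real] by simp
    then have l: "?l = real J - log 2 (real m)"
      using m_pos by (simp add: log_divide log_nat_power)
    have "2 < 2 * real N / real m"
      using m_less m_pos by (simp add: field_simps)
    then have l1: "1 < ?l"
      using m_pos m_less by (simp add: less_log_iff)
    have Q: "real (max 1 q) \<le> ?Q"
      using log_m by simp
    have "real (J - q) \<le> 2 * ?l"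
      using l l1 m_log log_m by (cases "q \<le> J") (simp_all add: of_nat_diff)
    then have "real W \<le> real m * 1 + 16 * real m * (2 * ?l)"
      using mult_left_mono[of "real (J - q)" "2 * ?l" "16 * real m"] by (simp add: W_def)
    also have "\<dots> \<le> real m * ?l + 16 * real m * (2 * ?l)"
      using l1 by (intro add_right_mono mult_left_mono) simp_all
    finally have W: "real W \<le> 33 * (real m * ?l)"
      by simp
    \<comment> \<open>Absorbs the cost of the first sample, which is taken before the first level.\<close>
    have ml: "1 \<le> real m * ?l"
      using m_pos l1 mult_mono[of 1 "real m" 1 ?l] by simp
    have "real (ops run) \<le> 8 + A * real (max 1 q) * real W"
      using of_nat_mono[OF cost(1), where ?'a = real] unfolding A_def by simp
    also have "\<dots> \<le> 8 * (?Q * (real m * ?l)) + A * ?Q * (33 * (real m * ?l))"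
    proof (intro add_mono mult_mono Q W order.refl)
      show "8 \<le> 8 * (?Q * (real m * ?l))"
        using ml mult_mono[of 1 ?Q 1 "real m * ?l"] by simp
    qed (auto simp: A_def)
    finally have ops: "real (ops run) \<le> (8 + 33 * A) * (real m * ?Q * ?l)"
      by (simp add: algebra_simps)
    have "real (card (set (samples run))) \<le> real (length (samples run))"
      by (simp add: card_length)
    also have "\<dots> \<le> 1 + 2 * real W"
      using of_nat_mono[OF cost(2), where ?'a = real] by simp
    also have "\<dots> \<le> 67 * (real m * ?l)"
      using W ml by linarith
    also have "\<dots> \<le> (8 + 33 * A) * (real m * ?l)"
      using ml by (intro mult_right_mono) (simp_all add: A_def)
    finally have samples: "real (card (set (samples run))) \<le> (8 + 33 * A) * (real m * ?l)" .
    show "let run = sparse_DCT ifft \<epsilon> J (cosine_mat_II N *\<^sub>v x) in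
       real (ops run) \<le> (8 + 33 * A) * (real m * ?Q * ?l) \<and>
       real (card (set (samples run))) \<le> (8 + 33 * A) * (real m * ?l)"
      using ops samples unfolding Let_def run_def by blast
  qed
qed

end
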